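(* Let $\mathcal B$ be a building with chamber set $C$. Let $V$ be the vertex set of the Tits complex $\Delta_T$ of $\mathcal B$. The following topologies on $\mathrm{Aut}(\mathcal B)$ coincide. (i) The topology of pointwise convergence on the discrete set $C$. (ii) The topology of pointwise convergence on the discrete set $V$. (iii) The topology of pointwise convergence (as maps $|\Delta_T|\to|\Delta_T|$), for any topology on $|\Delta_T|$ in which $V$ is a discrete subset. (iv) The compact-open topology, for the weak topology on $|\Delta_T|$. Suppose that $\mathrm{Aut}(\mathcal B)$ carries this topology and that $|\Delta_T|$ carries some topology. Then the joint evaluation map $\mathrm{Aut}(\mathcal B)\times|\Delta_T|\to|\Delta_T|$ is continuous if one of the following holds. (a) The topology on $|\Delta_T|$ is $\mathrm{Aut}(\mathcal B)$-invariant and locally finite. (b) The topology on $|\Delta_T|$ comes from an $\mathrm{Aut}(\mathcal B)$-invariant metric $d$ in which $V$ is discrete.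
   Context: All topological spaces and groups are Hausdorff. Coxeter systems. Let $I$ be a finite set and $(m_{i,j})_{i,j\in I}$ a symmetric matrix with entries in $\{1,2,3,\ldots,\infty\}$, $m_{i,i}=1$ and $m_{i,j}\ge 2$ for $i\ne j$. The associated Coxeter system $(W,I)$ consists of the group $W=\langle I\mid (ij)^{m_{i,j}}=1 \text{ if } m_{i,j}\neq\infty\rangle$ and its generating set $I$; $\ell$ is the word length, and $w=i_1\cdots i_m$ is reduced if $\ell(w)=m$. Buildings. A building $\mathcal B=(C,EC,t,\delta)$ of type $(W,I)$ consists of a simplicial graph $(C,EC)$ with vertex set $C$ (the chambers) and edge set $EC$, an edge coloring $t:EC\to I$, and a map $\delta:C\times C\to W$. Chambers joined by an edge of color $i$ are called $i$-adjacent. A gallery of type $(i_1,\ldots,i_m)$ is a sequence $(c_0,\ldots,c_m)$ of chambers with $c_{s-1}$ $i_s$-adjacent to $c_s$. Axioms: (B1) for every chamber $a$ and $i\in I$ there is at least one chamber $b$ which is $i$-adjacent to $a$, and if another chamber $c$ is $i$-adjacent to $a$, then $b$ and $c$ are $i$-adjacent; (B2) if $w=i_1\cdots i_m$ is reduced, then $\delta(a,b)=w$ if and only if there is a gallery of type $(i_1,\ldots,i_m)$ from $a$ to $b$. $\mathrm{Aut}(\mathcal B)$ is the group of all graph automorphisms of $(C,EC)$ preserving the edge coloring. Simplicial complexes. A simplicial complex $\Delta$ with vertex set $V$ is a set of finite subsets of $V$, closed under passing to subsets, with $\bigcup\Delta=V$. In the real vector space $\mathbb R^{(V)}$ with basis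 $V$ let $|a|$ be the convex hull of $a\in\Delta$; the geometric realization is the set $|\Delta|=\bigcup_{a\in\Delta}|a|$. In the weak topology, $A\subseteq|\Delta|$ is closed iff $A\cap|a|$ is closed in $|a|$ (with its natural compact topology) for all $a\in\Delta$. Simplicial maps (maps between vertex sets taking simplices to simplices) are extended linearly to the geometric realizations. A topology on $|\Delta|$ is called locally finite if every $x\in|\Delta|$ has a neighborhood contained in the geometric realization of a finite subcomplex of $\Delta$. Tits complex. For $c\in C$ and $J\subseteq I$, the residue $\mathrm{Res}_J(c)$ is the subgraph consisting of all chambers that can be reached from $c$ by galleries whose edge colors are in $J$, with the edges between them. The Tits complex $\Delta_T$ has vertex set $V=\{\mathrm{Res}_{I\setminus\{i\}}(c)\mid c\in C,\ i\in I\}$, and its simplices are the sets $\{\mathrm{Res}_{I\setminus\{i\}}(c)\mid i\in K\}$ for $c\in C$ and $K\subseteq I$ (this simplex corresponds to the residue $\mathrm{Res}_{I\setminus K}(c)$; $K=\varnothing$ gives the empty simplex). The group $\mathrm{Aut}(\mathcal B)$ acts on $\Delta_T$, hence on $|\Delta_T|$. A topology (resp. metric) on $|\Delta_T|$ is invariant if $\mathrm{Aut}(\mathcal B)$ acts by homeomorphisms (resp. isometries). A subset is discrete if its subspace topology is discrete. *)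

theory Defs
  imports "HOL-Analysis.Analysis" "HOL-Algebra.Bij"
begin

section \<open>Groups given by generators and relators\<close>

text \<open>A letter \<open>(s, True)\<close> stands for the generator \<open>s\<close>, and \<open>(s, False)\<close> for its formal inverse.\<close>

type_synonym 'i word = "('i \<times> bool) list"

definition words :: "'i set \<Rightarrow> 'i word set"
  where "words S = lists (S \<times> UNIV)"

inductive pres_eq :: "'i set \<Rightarrow> 'i word set \<Rightarrow> 'i word \<Rightarrow> 'i word \<Rightarrow> bool"
  for S :: "'i set" and R :: "'i word set"
  where
    refl: "u \<in> words S \<Longrightarrow> pres_eq S R u u"
  | sym: "pres_eq S R u v \<Longrightarrow> pres_eq S R v u"
  | trans: "pres_eq S R u v \<Longrightarrow> pres_eq S R v w \<Longrightarrow> pres_eq S R u w"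
  | cancel: "u \<in> words S \<Longrightarrow> v \<in> words S \<Longrightarrow> s \<in> S \<Longrightarrow>
      pres_eq S R (u @ [(s, b), (s, \<not> b)] @ v) (u @ v)"
  | relator: "u \<in> words S \<Longrightarrow> v \<in> words S \<Longrightarrow> r \<in> R \<Longrightarrow> r \<in> words S \<Longrightarrow>
      pres_eq S R (u @ r @ v) (u @ v)"

definition pres_class :: "'i set \<Rightarrow> 'i word set \<Rightarrow> 'i word \<Rightarrow> 'i word set"
  where "pres_class S R u = {v. pres_eq S R u v}"

definition presented_group :: "'i set \<Rightarrow> 'i word set \<Rightarrow> 'i word set monoid"
  where "presented_group S R =
    \<lparr> carrier = pres_class S R ` words S,
      mult = (\<lambda>A B. \<Union>u\<in>A. \<Union>v\<in>B. pres_class S R (u @ v)),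
      one = pres_class S R [] \<rparr>"

lemma pres_eq_words: "pres_eq S R u v \<Longrightarrow> u \<in> words S \<and> v \<in> words S"
  by (induction rule: pres_eq.induct) (auto simp: words_def)

lemma pres_eq_append:
  assumes "pres_eq S R u v" "x \<in> words S" "y \<in> words S"
  shows "pres_eq S R (x @ u @ y) (x @ v @ y)"
  using assms(1)
proof (induction rule: pres_eq.induct)
  case (refl u)
  then show ?case using assms(2,3) by (intro pres_eq.refl) (auto simp: words_def)
next
  case (sym u v)
  show ?case by (rule pres_eq.sym[OF sym.IH])
next
  case (trans u v w)
  show ?case by (rule pres_eq.trans[OF trans.IH])
next
  case (cancel u v s b)
  then show ?case
    using assms(2,3) pres_eq.cancel[of "x @ u" S "v @ y" s R b] by (auto simp: words_def)
next
  case (relator u v r)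
  then show ?case
    using assms(2,3) pres_eq.relator[of "x @ u" S "v @ y" r R] by (auto simp: words_def)
qed

lemma pres_eq_append2:
  assumes "pres_eq S R u u'" "pres_eq S R v v'"
  shows "pres_eq S R (u @ v) (u' @ v')"
proof -
  have "pres_eq S R (u @ v) (u' @ v)"
    using pres_eq_append[OF assms(1), of "[]" v] pres_eq_words[OF assms(2)]
    by (auto simp: words_def)
  moreover have "pres_eq S R (u' @ v) (u' @ v')"
    using pres_eq_append[OF assms(2), of u' "[]"] pres_eq_words[OF assms(1)]
    by (auto simp: words_def)
  ultimately show ?thesis by (rule pres_eq.trans)
qed

lemma pres_class_eq: "pres_eq S R u v \<Longrightarrow> pres_class S R u = pres_class S R v"
  unfolding pres_class_def by (intro Collect_cong iffI) (erule pres_eq.trans[OF pres_eq.sym], assumption, erule pres_eq.trans, assumption)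

lemma presented_group_mult:
  assumes "u \<in> words S" "v \<in> words S"
  shows "pres_class S R u \<otimes>\<^bsub>presented_group S R\<^esub> pres_class S R v = pres_class S R (u @ v)"
proof -
  have *: "pres_class S R (u' @ v') = pres_class S R (u @ v)"
    if "u' \<in> pres_class S R u" "v' \<in> pres_class S R v" for u' v'
  proof -
    have "pres_eq S R u u'" "pres_eq S R v v'" using that by (simp_all add: pres_class_def)
    then show ?thesis by (metis pres_class_eq pres_eq_append2)
  qed
  have ne: "pres_class S R u \<noteq> {}" "pres_class S R v \<noteq> {}"
    using assms by (auto simp: pres_class_def intro: pres_eq.refl)
  have "(\<Union>u'\<in>pres_class S R u. \<Union>v'\<in>pres_class S R v. pres_class S R (u' @ v')) =
      (\<Union>u'\<in>pres_class S R u. \<Union>v'\<in>pres_class S R v. pres_class S R (u @ v))"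
    by (intro SUP_cong HOL.refl *)
  also have "\<dots> = pres_class S R (u @ v)" using ne by simp
  finally show ?thesis by (simp add: presented_group_def)
qed

lemma pres_eq_inverse:
  assumes "u \<in> words S"
  shows "pres_eq S R (rev (map (\<lambda>(s, b). (s, \<not> b)) u) @ u) []"
  using assms
proof (induction u)
  case Nil
  then show ?case by (auto intro: pres_eq.refl)
next
  case (Cons a u)
  obtain s b where a: "a = (s, b)" by (cases a)
  let ?w = "rev (map (\<lambda>(s, b). (s, \<not> b)) u)"
  have "u \<in> words S" "s \<in> S" using Cons.prems a by (auto simp: words_def)
  moreover have "?w \<in> words S" using \<open>u \<in> words S\<close> by (auto simp: words_def)
  ultimately have "pres_eq S R (?w @ [(s, \<not> b), (s, \<not> \<not> b)] @ u) (?w @ u)"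
    by (intro pres_eq.cancel)
  from pres_eq.trans[OF this Cons.IH[OF \<open>u \<in> words S\<close>]] show ?case by (simp add: a)
qed

lemma group_presented_group: "group (presented_group S R)"
proof (rule groupI)
  let ?G = "presented_group S R"
  have carr: "carrier ?G = pres_class S R ` words S"
    and one: "\<one>\<^bsub>?G\<^esub> = pres_class S R []"
    by (auto simp: presented_group_def)
  have app: "u @ v \<in> words S" if "u \<in> words S" "v \<in> words S" for u v :: "'a word"
    using that by (auto simp: words_def)
  show "\<one>\<^bsub>?G\<^esub> \<in> carrier ?G" by (auto simp: carr one words_def)
  show "\<one>\<^bsub>?G\<^esub> \<otimes>\<^bsub>?G\<^esub> x = x" if "x \<in> carrier ?G" for x
  proof -
    have "[] \<in> words S" by (simp add: words_def)
    then show ?thesis using that by (auto simp: carr one presented_group_mult)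
  qed
  show "x \<otimes>\<^bsub>?G\<^esub> y \<in> carrier ?G" if "x \<in> carrier ?G" "y \<in> carrier ?G" for x y
    using that app by (auto simp: carr presented_group_mult)
  show "x \<otimes>\<^bsub>?G\<^esub> y \<otimes>\<^bsub>?G\<^esub> z = x \<otimes>\<^bsub>?G\<^esub> (y \<otimes>\<^bsub>?G\<^esub> z)"
    if "x \<in> carrier ?G" "y \<in> carrier ?G" "z \<in> carrier ?G" for x y z
    using that app by (auto simp: carr presented_group_mult)
  show "\<exists>y\<in>carrier ?G. y \<otimes>\<^bsub>?G\<^esub> x = \<one>\<^bsub>?G\<^esub>" if x: "x \<in> carrier ?G" for x
  proof -
    obtain u where u: "u \<in> words S" "x = pres_class S R u" using x carr by auto
    let ?w = "rev (map (\<lambda>(s, b). (s, \<not> b)) u)"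
    have "?w \<in> words S" using u by (auto simp: words_def)
    then show ?thesis
      using u pres_class_eq[OF pres_eq_inverse[OF u(1)], of R]
      by (intro bexI[of _ "pres_class S R ?w"]) (simp_all add: carr one presented_group_mult)
  qed
qed

section \<open>Coxeter systems\<close>

definition coxeter_matrix :: "'i set \<Rightarrow> ('i \<Rightarrow> 'i \<Rightarrow> enat) \<Rightarrow> bool"
  where "coxeter_matrix I m \<longleftrightarrow>
    finite I \<and>
    (\<forall>i\<in>I. \<forall>j\<in>I. m i j = m j i) \<and>
    (\<forall>i\<in>I. m i i = 1) \<and>
    (\<forall>i\<in>I. \<forall>j\<in>I. i \<noteq> j \<longrightarrow> m i j \<ge> 2)"

definition coxeter_relators :: "'i set \<Rightarrow> ('i \<Rightarrow> 'i \<Rightarrow> enat) \<Rightarrow> 'i word set"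
  where "coxeter_relators I m =
    {concat (replicate (the_enat (m i j)) [(i, True), (j, True)]) | i j.
      i \<in> I \<and> j \<in> I \<and> m i j \<noteq> \<infinity>}"

definition coxeter_group :: "'i set \<Rightarrow> ('i \<Rightarrow> 'i \<Rightarrow> enat) \<Rightarrow> 'i word set monoid"
  where "coxeter_group I m = presented_group I (coxeter_relators I m)"

definition coxeter_generator :: "'i set \<Rightarrow> ('i \<Rightarrow> 'i \<Rightarrow> enat) \<Rightarrow> 'i \<Rightarrow> 'i word set"
  where "coxeter_generator I m i = pres_class I (coxeter_relators I m) [(i, True)]"

definition coxeter_prod :: "'i set \<Rightarrow> ('i \<Rightarrow> 'i \<Rightarrow> enat) \<Rightarrow> 'i list \<Rightarrow> 'i word set"
  where "coxeter_prod I m is =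
    foldr (\<lambda>i w. coxeter_generator I m i \<otimes>\<^bsub>coxeter_group I m\<^esub> w) is \<one>\<^bsub>coxeter_group I m\<^esub>"

text \<open>As \<open>m i i = 1\<close>, the generators are involutions, so formal inverses need not be
  considered in the word length.\<close>

definition coxeter_length :: "'i set \<Rightarrow> ('i \<Rightarrow> 'i \<Rightarrow> enat) \<Rightarrow> 'i word set \<Rightarrow> nat"
  where "coxeter_length I m w =
    (LEAST n. \<exists>is. set is \<subseteq> I \<and> length is = n \<and> coxeter_prod I m is = w)"

definition coxeter_reduced :: "'i set \<Rightarrow> ('i \<Rightarrow> 'i \<Rightarrow> enat) \<Rightarrow> 'i list \<Rightarrow> bool"
  where "coxeter_reduced I m is \<longleftrightarrow>
    set is \<subseteq> I \<and> coxeter_length I m (coxeter_prod I m is) = length is"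

section \<open>Buildings\<close>

definition adjacent :: "'c set set \<Rightarrow> ('c set \<Rightarrow> 'i) \<Rightarrow> 'i \<Rightarrow> 'c \<Rightarrow> 'c \<Rightarrow> bool"
  where "adjacent EC t i a b \<longleftrightarrow> {a, b} \<in> EC \<and> t {a, b} = i"

definition gallery ::
    "'c set \<Rightarrow> 'c set set \<Rightarrow> ('c set \<Rightarrow> 'i) \<Rightarrow> 'i list \<Rightarrow> 'c list \<Rightarrow> bool"
  where "gallery C EC t is cs \<longleftrightarrow>
    set cs \<subseteq> C \<and> length cs = Suc (length is) \<and>
    (\<forall>s<length is. adjacent EC t (is ! s) (cs ! s) (cs ! Suc s))"

definition gallery_from_to ::
    "'c set \<Rightarrow> 'c set set \<Rightarrow> ('c set \<Rightarrow> 'i) \<Rightarrow> 'i list \<Rightarrow> 'c \<Rightarrow> 'c \<Rightarrow> bool"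
  where "gallery_from_to C EC t is a b \<longleftrightarrow>
    (\<exists>cs. gallery C EC t is cs \<and> hd cs = a \<and> last cs = b)"

locale building =
  fixes I :: "'i set" and m :: "'i \<Rightarrow> 'i \<Rightarrow> enat"
    and C :: "'c set" and EC :: "'c set set" and t :: "'c set \<Rightarrow> 'i"
    and \<delta> :: "'c \<Rightarrow> 'c \<Rightarrow> 'i word set"
  assumes coxeter: "coxeter_matrix I m"
    and simplicial_graph: "\<And>e. e \<in> EC \<Longrightarrow> e \<subseteq> C \<and> card e = 2"
    and coloring: "t \<in> EC \<rightarrow> I"
    and distance: "\<delta> \<in> C \<rightarrow> C \<rightarrow> carrier (coxeter_group I m)"
    and B1_ex: "\<And>a i. a \<in> C \<Longrightarrow> i \<in> I \<Longrightarrow> \<exists>b\<in>C. adjacent EC t i a b"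
    and B1_trans: "\<And>a b c i. a \<in> C \<Longrightarrow> i \<in> I \<Longrightarrow>
      adjacent EC t i a b \<Longrightarrow> adjacent EC t i a c \<Longrightarrow> b \<noteq> c \<Longrightarrow> adjacent EC t i b c"
    and B2: "\<And>is a b. coxeter_reduced I m is \<Longrightarrow> a \<in> C \<Longrightarrow> b \<in> C \<Longrightarrow>
      \<delta> a b = coxeter_prod I m is \<longleftrightarrow> gallery_from_to C EC t is a b"

text \<open>Automorphisms are extensional functions (\<open>undefined\<close> off \<open>C\<close>), so that distinct elements
  are distinct permutations of \<open>C\<close>.\<close>

definition building_Aut :: "'c set \<Rightarrow> 'c set set \<Rightarrow> ('c set \<Rightarrow> 'i) \<Rightarrow> ('c \<Rightarrow> 'c) monoid"
  where "building_Aut C EC t = (BijGroup C)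
    \<lparr>carrier := {g \<in> Bij C.
       (\<forall>a\<in>C. \<forall>b\<in>C. {g a, g b} \<in> EC \<longleftrightarrow> {a, b} \<in> EC) \<and>
       (\<forall>e\<in>EC. t (g ` e) = t e)}\<rparr>"

section \<open>Simplicial complexes\<close>

definition simplicial_complex :: "'v set \<Rightarrow> 'v set set \<Rightarrow> bool"
  where "simplicial_complex V \<Delta> \<longleftrightarrow>
    (\<forall>a\<in>\<Delta>. finite a) \<and> (\<forall>a\<in>\<Delta>. \<forall>b. b \<subseteq> a \<longrightarrow> b \<in> \<Delta>) \<and> \<Union>\<Delta> = V"

definition subcomplex :: "'v set set \<Rightarrow> 'v set set \<Rightarrow> bool"
  where "subcomplex F \<Delta> \<longleftrightarrow> F \<subseteq> \<Delta> \<and> simplicial_complex (\<Union>F) F"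

text \<open>The vector space with basis \<open>V\<close> is represented by finitely supported functions
  \<open>'v \<Rightarrow> real\<close>, a function \<open>x\<close> standing for the sum of all \<open>x v *\<^sub>R v\<close>.\<close>

definition vertex_point :: "'v \<Rightarrow> 'v \<Rightarrow> real"
  where "vertex_point v = (\<lambda>u. if u = v then 1 else 0)"

text \<open>The convex hull of the finite set of basis vectors \<open>vertex_point v\<close>, \<open>v \<in> a\<close>
  (empty if \<open>a\<close> is empty).\<close>

definition real_simplex :: "'v set \<Rightarrow> ('v \<Rightarrow> real) set"
  where "real_simplex a =
    {(\<lambda>u. \<Sum>v\<in>a. c v * vertex_point v u) | c. (\<forall>v\<in>a. c v \<ge> 0) \<and> (\<Sum>v\<in>a. c v) = 1}"

definition realization :: "'v set set \<Rightarrow> ('v \<Rightarrow> real) set"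
  where "realization \<Delta> = (\<Union>a\<in>\<Delta>. real_simplex a)"

text \<open>The natural topology of a simplex is that of coordinatewise convergence; only finitely
  many coordinates are non-zero on a given simplex.\<close>

definition simplex_topology :: "'v set \<Rightarrow> ('v \<Rightarrow> real) topology"
  where "simplex_topology a = subtopology (powertop_real UNIV) (real_simplex a)"

definition weak_topology :: "'v set set \<Rightarrow> ('v \<Rightarrow> real) topology"
  where "weak_topology \<Delta> = topology (\<lambda>U. U \<subseteq> realization \<Delta> \<and>
    (\<forall>a\<in>\<Delta>. closedin (simplex_topology a) ((realization \<Delta> - U) \<inter> real_simplex a)))"

text \<open>The extension to the geometric realizations of a map \<open>f\<close> between vertex sets: the sum of
  all \<open>x v *\<^sub>R v\<close> is mapped to the sum of all \<open>x v *\<^sub>R f v\<close>.\<close>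

definition linear_extension :: "('v \<Rightarrow> 'w) \<Rightarrow> ('v \<Rightarrow> real) \<Rightarrow> ('w \<Rightarrow> real)"
  where "linear_extension f x = (\<lambda>u. \<Sum>v | x v \<noteq> 0. x v * vertex_point (f v) u)"

definition locally_finite_topology :: "'v set set \<Rightarrow> ('v \<Rightarrow> real) topology \<Rightarrow> bool"
  where "locally_finite_topology \<Delta> X \<longleftrightarrow>
    (\<forall>x\<in>topspace X. \<exists>U F. openin X U \<and> x \<in> U \<and>
       finite F \<and> subcomplex F \<Delta> \<and> U \<subseteq> realization F)"

lemma topspace_simplex_topology: "topspace (simplex_topology a) = real_simplex a"
  by (simp add: simplex_topology_def)

lemma openin_weak_topology:
  "openin (weak_topology \<Delta>) U \<longleftrightarrow>
    U \<subseteq> realization \<Delta> \<and>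
    (\<forall>a\<in>\<Delta>. closedin (simplex_topology a) ((realization \<Delta> - U) \<inter> real_simplex a))"
proof -
  let ?P = "\<lambda>U. U \<subseteq> realization \<Delta> \<and>
    (\<forall>a\<in>\<Delta>. closedin (simplex_topology a) ((realization \<Delta> - U) \<inter> real_simplex a))"
  have "istopology ?P"
    unfolding istopology_def
  proof (intro conjI allI impI)
    fix S T assume S: "?P S" and T: "?P T"
    show "S \<inter> T \<subseteq> realization \<Delta>" using S by blast
    show "\<forall>a\<in>\<Delta>. closedin (simplex_topology a) ((realization \<Delta> - S \<inter> T) \<inter> real_simplex a)"
    proof
      fix a assume "a \<in> \<Delta>"
      moreover have "(realization \<Delta> - S \<inter> T) \<inter> real_simplex a =
        (realization \<Delta> - S) \<inter> real_simplex a \<union> (realization \<Delta> - T) \<inter> real_simplex a" by blast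
      ultimately show "closedin (simplex_topology a) ((realization \<Delta> - S \<inter> T) \<inter> real_simplex a)"
        using S T by (metis closedin_Un)
    qed
  next
    fix K assume K: "\<forall>U\<in>K. ?P U"
    show "\<Union>K \<subseteq> realization \<Delta>" using K by blast
    show "\<forall>a\<in>\<Delta>. closedin (simplex_topology a) ((realization \<Delta> - \<Union>K) \<inter> real_simplex a)"
    proof
      fix a assume a: "a \<in> \<Delta>"
      have "(realization \<Delta> - \<Union>K) \<inter> real_simplex a = real_simplex a \<inter>
          \<Inter>((\<lambda>U. (realization \<Delta> - U) \<inter> real_simplex a) ` K)"
        using a by (auto simp: realization_def)
      moreover have "closedin (simplex_topology a) \<dots>"
      proof (cases "K = {}")
        case True
        then show ?thesis by (simp flip: topspace_simplex_topology)
      next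
        case False
        then have "closedin (simplex_topology a)
            (\<Inter>((\<lambda>U. (realization \<Delta> - U) \<inter> real_simplex a) ` K))"
          using K a by (intro closedin_Inter) auto
        then show ?thesis by (metis closedin_Int closedin_topspace topspace_simplex_topology)
      qed
      ultimately show "closedin (simplex_topology a) ((realization \<Delta> - \<Union>K) \<inter> real_simplex a)"
        by simp
    qed
  qed
  then show ?thesis unfolding weak_topology_def by (simp add: topology_inverse')
qed

lemma topspace_weak_topology: "topspace (weak_topology \<Delta>) = realization \<Delta>"
proof -
  have "openin (weak_topology \<Delta>) (realization \<Delta>)" by (simp add: openin_weak_topology)
  then show ?thesis
    by (metis openin_subset openin_topspace openin_weak_topology subset_antisym)
qed

lemma closedin_weak_topology:
  "closedin (weak_topology \<Delta>) A \<longleftrightarrow>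
    A \<subseteq> realization \<Delta> \<and> (\<forall>a\<in>\<Delta>. closedin (simplex_topology a) (A \<inter> real_simplex a))"
proof -
  have "realization \<Delta> - (realization \<Delta> - A) = A" if "A \<subseteq> realization \<Delta>" using that by blast
  then show ?thesis
    by (auto simp: closedin_def[of "weak_topology \<Delta>"] topspace_weak_topology openin_weak_topology)
qed

section \<open>The Tits complex\<close>

text \<open>A residue is a subgraph, that is, a pair consisting of its chambers and its edges.\<close>

type_synonym 'c residue = "'c set \<times> 'c set set"

definition residue ::
    "'c set \<Rightarrow> 'c set set \<Rightarrow> ('c set \<Rightarrow> 'i) \<Rightarrow> 'i set \<Rightarrow> 'c \<Rightarrow> 'c residue"
  where "residue C EC t J c =
    (let S = {d. \<exists>is. set is \<subseteq> J \<and> gallery_from_to C EC t is c d}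
     in (S, {e \<in> EC. e \<subseteq> S}))"

definition tits_vertices ::
    "'i set \<Rightarrow> 'c set \<Rightarrow> 'c set set \<Rightarrow> ('c set \<Rightarrow> 'i) \<Rightarrow> 'c residue set"
  where "tits_vertices I C EC t = {residue C EC t (I - {i}) c | c i. c \<in> C \<and> i \<in> I}"

definition tits_complex ::
    "'i set \<Rightarrow> 'c set \<Rightarrow> 'c set set \<Rightarrow> ('c set \<Rightarrow> 'i) \<Rightarrow> 'c residue set set"
  where "tits_complex I C EC t =
    {(\<lambda>i. residue C EC t (I - {i}) c) ` K | c K. c \<in> C \<and> K \<subseteq> I}"

lemma simplicial_complex_tits_complex:
  assumes "finite I"
  shows "simplicial_complex (tits_vertices I C EC t) (tits_complex I C EC t)"
proof -
  have "b \<in> tits_complex I C EC t" if a: "a \<in> tits_complex I C EC t" and b: "b \<subseteq> a" for a b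
  proof -
    obtain c K where "c \<in> C" "K \<subseteq> I" and eq: "a = (\<lambda>i. residue C EC t (I - {i}) c) ` K"
      using a unfolding tits_complex_def by blast
    obtain K' where "K' \<subseteq> K" "b = (\<lambda>i. residue C EC t (I - {i}) c) ` K'"
      using b[unfolded eq] by (rule subset_imageE)
    with \<open>c \<in> C\<close> \<open>K \<subseteq> I\<close> show ?thesis
      unfolding tits_complex_def by (intro CollectI exI[of _ c] exI[of _ K'] conjI) auto
  qed
  moreover have "finite a" if "a \<in> tits_complex I C EC t" for a
    using that assms by (auto simp: tits_complex_def dest: finite_subset)
  moreover have "\<Union>(tits_complex I C EC t) = tits_vertices I C EC t"
  proof
    show "\<Union>(tits_complex I C EC t) \<subseteq> tits_vertices I C EC t"
      unfolding tits_complex_def tits_vertices_def by blast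
    have "residue C EC t (I - {i}) c \<in> \<Union>(tits_complex I C EC t)" if "c \<in> C" "i \<in> I" for c i
    proof
      show "(\<lambda>i. residue C EC t (I - {i}) c) ` {i} \<in> tits_complex I C EC t"
        unfolding tits_complex_def using that
        by (intro CollectI exI[of _ c] exI[of _ "{i}"] conjI) auto
    qed simp
    then show "tits_vertices I C EC t \<subseteq> \<Union>(tits_complex I C EC t)"
      unfolding tits_vertices_def by blast
  qed
  ultimately show ?thesis by (auto simp: simplicial_complex_def)
qed

definition residue_act :: "('c \<Rightarrow> 'c) \<Rightarrow> 'c residue \<Rightarrow> 'c residue"
  where "residue_act g = (\<lambda>(S, E). (g ` S, (\<lambda>e. g ` e) ` E))"

definition tits_act :: "('c \<Rightarrow> 'c) \<Rightarrow> ('c residue \<Rightarrow> real) \<Rightarrow> ('c residue \<Rightarrow> real)"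
  where "tits_act g = linear_extension (residue_act g)"

section \<open>Topologies on a set of transformations\<close>

definition discrete_subset :: "'a topology \<Rightarrow> 'a set \<Rightarrow> bool"
  where "discrete_subset X S \<longleftrightarrow> S \<subseteq> topspace X \<and> subtopology X S = discrete_topology S"

text \<open>Every \<open>g \<in> G\<close> acts on the topological space \<open>X\<close> by \<open>act g\<close>. Both topologies are those
  induced on \<open>G\<close> from the set of maps from \<open>X\<close> to itself.\<close>

definition pointwise_topology ::
    "'g set \<Rightarrow> ('g \<Rightarrow> 'a \<Rightarrow> 'a) \<Rightarrow> 'a topology \<Rightarrow> 'g topology"
  where "pointwise_topology G act X =
    pullback_topology G (\<lambda>g. restrict (act g) (topspace X))
      (product_topology (\<lambda>_. X) (topspace X))"

definition compact_open_topology ::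
    "'g set \<Rightarrow> ('g \<Rightarrow> 'a \<Rightarrow> 'a) \<Rightarrow> 'a topology \<Rightarrow> 'g topology"
  where "compact_open_topology G act X =
    topology_generated_by
      {{g \<in> G. act g ` K \<subseteq> U} | K U. compactin X K \<and> openin X U}"

definition invariant_topology :: "'g set \<Rightarrow> ('g \<Rightarrow> 'a \<Rightarrow> 'a) \<Rightarrow> 'a topology \<Rightarrow> bool"
  where "invariant_topology G act X \<longleftrightarrow> (\<forall>g\<in>G. homeomorphic_map X X (act g))"

definition invariant_metric ::
    "'g set \<Rightarrow> ('g \<Rightarrow> 'a \<Rightarrow> 'a) \<Rightarrow> 'a set \<Rightarrow> ('a \<Rightarrow> 'a \<Rightarrow> real) \<Rightarrow> bool"
  where "invariant_metric G act M d \<longleftrightarrow>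
    (\<forall>g\<in>G. bij_betw (act g) M M \<and> (\<forall>x\<in>M. \<forall>y\<in>M. d (act g x) (act g y) = d x y))"

end

theory Submission
  imports Defs
begin

text \<open>
  All topologies are compared with the first one, in which a neighbourhood of an automorphism \<open>g\<close>
  prescribes the values of \<open>g\<close> at finitely many chambers.

  The image of one chamber \<open>c\<close> under an automorphism determines the images of all vertices of the
  simplex of \<open>c\<close>, hence the map on the whole geometric simplex. So the automorphisms near \<open>g\<close>
  agree with \<open>g\<close> on any given finite subcomplex (\<open>agreement_on_finite_subcomplex\<close>). This makes the
  topology on chambers at least as fine as the three others: evaluations at vertices and at points
  are locally constant, and a set that is compact in the weak topology lies in a finite subcomplex
  (\<open>compact_in_finitely_many_simplices\<close>). It also gives the continuity of the evaluation map: in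
  case (a) a point has a neighbourhood inside a finite subcomplex, and in case (b) it suffices to
  fix the image of the point and to use that the automorphisms are isometries.

  Conversely, if the vertices form a discrete subset, the topology on \<open>|\<Delta>\<^sub>T|\<close> controls the images
  of single vertices. What remains is that finitely many vertices control a chamber, and this is where
  the theory of buildings enters: a chamber is determined by its vertices
  (\<open>corners_determine_chamber\<close>). If \<open>a\<close> and \<open>b\<close> have the same vertices, then for each \<open>i\<close> there is
  a gallery from \<open>a\<close> to \<open>b\<close> that avoids the colour \<open>i\<close>, so \<open>\<delta> a b\<close> is a product of generators
  other than \<open>i\<close> (\<open>gallery_delta_in_parabolic\<close>). The subgroups of the Coxeter group generated by the
  sets \<open>I - {i}\<close> have trivial intersection (\<open>parabolic_intersection_trivial\<close>), so
  \<open>\<delta> a b = 1\<close> and \<open>a = b\<close>.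

  The statement about Coxeter groups is proved with the reflection cocycle: a word describes a path
  in the Cayley graph, and the parity with which it crosses the wall of a given reflection depends
  only on the product of the word, because the defining relators cross every wall an even number of
  times.
\<close>


section \<open>Reflections crossed by a word in involutive generators\<close>

lemma distinct_count_one: "distinct xs \<Longrightarrow> x \<in> set xs \<Longrightarrow> count_list xs x = 1"
  by (induction xs) auto

text \<open>The intersection of the parabolic subgroups of a Coxeter group is computed from three
  properties: the generators are involutions, they are distinct, and a certain parity attached to a
  word depends on its product alone. The first property is used here, the others are added below.\<close>

locale involutive_family = group G for G (structure) +
  fixes s :: "'i \<Rightarrow> 'a" and I :: "'i set"
  assumes s_closed [simp]: "i \<in> I \<Longrightarrow> s i \<in> carrier G"
    and s_square: "i \<in> I \<Longrightarrow> s i \<otimes> s i = \<one>"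
begin

definition word_prod :: "'i list \<Rightarrow> 'a"
  where "word_prod f = foldr (\<lambda>i w. s i \<otimes> w) f \<one>"

lemma word_prod_simps [simp]: "word_prod [] = \<one>" "word_prod (i # f) = s i \<otimes> word_prod f"
  by (simp_all add: word_prod_def)

lemma word_prod_closed [simp]: "set f \<subseteq> I \<Longrightarrow> word_prod f \<in> carrier G"
  by (induction f) auto

lemma word_prod_append:
  "set f \<subseteq> I \<Longrightarrow> set g \<subseteq> I \<Longrightarrow> word_prod (f @ g) = word_prod f \<otimes> word_prod g"
  by (induction f) (auto simp: m_assoc)

lemma inv_s: "i \<in> I \<Longrightarrow> inv (s i) = s i"
  by (simp add: inv_equality s_square)

lemma s_s_cancel: "i \<in> I \<Longrightarrow> x \<in> carrier G \<Longrightarrow> s i \<otimes> (s i \<otimes> x) = x"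
  by (simp flip: m_assoc add: s_square)

lemma word_prod_rev: "set f \<subseteq> I \<Longrightarrow> word_prod (rev f) = inv (word_prod f)"
  by (induction f) (auto simp: word_prod_append inv_mult_group inv_s)

text \<open>For a word \<open>i\<^sub>1 \<dots> i\<^sub>k\<close> this is the list of the conjugates
  \<open>(s\<^sub>1 \<dots> s\<^sub>p) s\<^sub>p (s\<^sub>1 \<dots> s\<^sub>p)\<inverse>\<close>: in the Cayley graph, the walls that the path
  spelled by the word crosses, in the order of crossing.\<close>

primrec reflections :: "'i list \<Rightarrow> 'a list" where
  "reflections [] = []"
| "reflections (i # f) = s i # map (\<lambda>t. s i \<otimes> t \<otimes> inv (s i)) (reflections f)"

lemma length_reflections [simp]: "length (reflections f) = length f"
  by (induction f) auto

lemma reflections_closed: "set f \<subseteq> I \<Longrightarrow> set (reflections f) \<subseteq> carrier G"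
  by (induction f) auto

lemma reflections_append:
  assumes "set f \<subseteq> I" "set g \<subseteq> I"
  shows "reflections (f @ g) =
    reflections f @ map (\<lambda>t. word_prod f \<otimes> t \<otimes> inv (word_prod f)) (reflections g)"
  using assms(1)
proof (induction f)
  case Nil
  show ?case using reflections_closed[OF assms(2)] by (auto simp: subset_iff intro!: map_idI[symmetric])
next
  case (Cons i f)
  then show ?case
    using reflections_closed[OF assms(2)] by (auto simp: inv_mult_group m_assoc subset_iff)
qed

text \<open>The reflections of \<open>(i j)\<^sup>k\<close> form a sequence in which each step multiplies
  by \<open>s i \<otimes> s j\<close>. So they repeat with period \<open>k\<close> as soon as the \<open>k\<close>-th power of that
  product is trivial; this is the form in which the Coxeter relations are used.\<close>

lemma reflections_alternating:
  assumes "i \<in> I" "j \<in> I"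
  shows "reflections (concat (replicate k [i, j])) =
    map (\<lambda>p. (s i \<otimes> s j) [^] p \<otimes> s i) [0..<2 * k]"
proof (induction k)
  case (Suc k)
  let ?x = "s i \<otimes> s j"
  \<comment> \<open>two letters in front conjugate by \<open>s i \<otimes> s j\<close>, which shifts the exponent by 2\<close>
  have conj: "s i \<otimes> (s j \<otimes> (?x [^] p \<otimes> s i) \<otimes> inv (s j)) \<otimes> inv (s i) = ?x [^] Suc (Suc p) \<otimes> s i" for p
  proof -
    have "?x [^] Suc (Suc p) = ?x \<otimes> (?x [^] p \<otimes> ?x)"
      using assms by (metis m_closed nat_pow_Suc nat_pow_Suc2 s_closed)
    then show ?thesis using assms by (simp add: inv_s m_assoc)
  qed
  have "[0..<2 * Suc k] = 0 # 1 # map (\<lambda>p. Suc (Suc p)) [0..<2 * k]"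
    by (simp add: map_Suc_upt upt_conv_Cons flip: map_map[of Suc Suc, unfolded comp_def])
  then show ?case using Suc assms conj by (simp add: inv_s del: upt_Suc nat_pow_Suc)
qed simp

lemma word_prod_alternating:
  assumes "i \<in> I" "j \<in> I"
  shows "word_prod (concat (replicate k [i, j])) = (s i \<otimes> s j) [^] k"
proof (induction k)
  case (Suc k)
  have "(s i \<otimes> s j) [^] Suc k = s i \<otimes> s j \<otimes> (s i \<otimes> s j) [^] k"
    using assms by (metis m_closed nat_pow_Suc2 s_closed)
  with Suc assms show ?case by (simp add: m_assoc)
qed simp

text \<open>This is the reflection cocycle of Bourbaki: which walls are crossed an odd number
  of times, that is, which walls separate the two ends of the path.\<close>

definition parity :: "'i list \<Rightarrow> 'a \<Rightarrow> bool"
  where "parity f t \<longleftrightarrow> odd (count_list (reflections f) t)"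

text \<open>A closed path that crosses each of its walls twice can be inserted anywhere: the path
  after it starts from the same element, and the insertion adds an even number to every count.\<close>

lemma parity_insert:
  assumes "set f \<subseteq> I" "set r \<subseteq> I" "set g \<subseteq> I"
    and "word_prod r = \<one>" and "reflections r = L @ L"
  shows "parity (f @ r @ g) = parity (f @ g)"
proof
  fix t
  have "reflections (r @ g) = L @ L @ reflections g"
    using assms reflections_closed[OF assms(3)]
    by (auto simp: reflections_append subset_iff intro!: map_idI)
  then show "parity (f @ r @ g) t = parity (f @ g) t"
    using assms by (auto simp: parity_def reflections_append)
qed

text \<open>Reflecting the end of a path in a wall that the path crosses amounts to skipping the
  letter at the crossing.\<close>

lemma reflection_deletes_letter:
  assumes "set f \<subseteq> I" "t \<in> set (reflections f)"
  shows "\<exists>g. set g \<subseteq> set f \<and> length g < length f \<and> word_prod g = t \<otimes> word_prod f"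
  using assms
proof (induction f arbitrary: t)
  case (Cons i f)
  consider "t = s i" | t' where "t' \<in> set (reflections f)" "t = s i \<otimes> t' \<otimes> inv (s i)"
    using Cons.prems by auto
  then show ?case
  proof cases
    case 1
    then show ?thesis using Cons.prems by (intro exI[of _ f]) (auto simp: s_s_cancel)
  next
    case 2
    with Cons.prems obtain g where g: "set g \<subseteq> set f" "length g < length f" "word_prod g = t' \<otimes> word_prod f"
      using Cons.IH[of t'] by auto
    have "t' \<in> carrier G" using 2 Cons.prems reflections_closed[of f] by auto
    then have "word_prod (i # g) = t \<otimes> word_prod (i # f)"
      using 2 g Cons.prems by (simp add: m_assoc inv_s s_s_cancel)
    with g show ?thesis by (intro exI[of _ "i # g"]) auto
  qed
qed simp

lemma reflection_in_parabolic:
  assumes "set f \<subseteq> I" "t \<in> set (reflections f)"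
  shows "\<exists>g. set g \<subseteq> set f \<and> word_prod g = t"
proof -
  obtain g where g: "set g \<subseteq> set f" "word_prod g = t \<otimes> word_prod f"
    using reflection_deletes_letter[OF assms] by blast
  moreover have "t \<in> carrier G" using assms reflections_closed by blast
  ultimately have "word_prod (g @ rev f) = t"
    using assms(1) by (subst word_prod_append) (auto simp: word_prod_rev m_assoc)
  with g show ?thesis by (intro exI[of _ "g @ rev f"]) auto
qed

text \<open>If a path crosses a wall twice, the part between the two crossings can be reflected,
  which saves both letters. By induction on the word, the first crossing may be taken at the first
  letter, and then \<open>reflection_deletes_letter\<close> does the rest.\<close>

lemma deletion:
  assumes "set f \<subseteq> I" "\<not> distinct (reflections f)"
  shows "\<exists>g. set g \<subseteq> set f \<and> length g < length f \<and> word_prod g = word_prod f"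
  using assms
proof (induction f)
  case (Cons i f)
  let ?c = "\<lambda>t. s i \<otimes> t \<otimes> inv (s i)"
  have i: "i \<in> I" and f: "set f \<subseteq> I" using Cons.prems by auto
  have inj: "inj_on ?c (set (reflections f))"
    using reflections_closed[OF f] i by (intro inj_onI) (auto simp: subset_iff)
  show ?case
  proof (cases "distinct (reflections f)")
    case False
    then obtain g where "set g \<subseteq> set f" "length g < length f" "word_prod g = word_prod f"
      using Cons.IH f by blast
    then show ?thesis by (intro exI[of _ "i # g"]) auto
  next
    case True
    then obtain t where t: "t \<in> set (reflections f)" "s i = ?c t"
      using Cons.prems(2) inj by (auto simp: distinct_map)
    have tc: "t \<in> carrier G" using t reflections_closed[OF f] by auto
    have "s i \<otimes> t = s i \<otimes> s i" using t(2) i tc by (metis inv_solve_right s_closed m_closed inv_s)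
    \<comment> \<open>the wall of the first letter is crossed again by the rest of the word\<close>
    then have "t = s i" using i tc by simp
    then obtain g where "set g \<subseteq> set f" "length g < length f" "word_prod g = s i \<otimes> word_prod f"
      using reflection_deletes_letter[OF f t(1)] by auto
    then show ?thesis by (intro exI[of _ g]) auto
  qed
qed simp

text \<open>By \<open>deletion\<close>, a word of minimal length among the words in \<open>J\<close> with a given product
  crosses no wall twice.\<close>

lemma shortest_word:
  assumes "J \<subseteq> I" "set f \<subseteq> J"
  obtains g where "set g \<subseteq> J" "word_prod g = word_prod f" "distinct (reflections g)"
proof -
  let ?P = "\<lambda>g. set g \<subseteq> J \<and> word_prod g = word_prod f"
  let ?g = "arg_min length ?P"
  have P: "?P ?g" and min: "\<And>h. ?P h \<Longrightarrow> length ?g \<le> length h"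
    using arg_min_nat_lemma[of ?P f length] assms by auto
  have "distinct (reflections ?g)"
  proof (rule ccontr)
    assume "\<not> distinct (reflections ?g)"
    with P assms(1) obtain h where "set h \<subseteq> set ?g" "length h < length ?g" "word_prod h = word_prod ?g"
      using deletion[of ?g] by auto
    with P min[of h] show False by auto
  qed
  with P show thesis by (intro that[of ?g]) auto
qed

end

text \<open>In a group presented by the squares of the generators and by the relations
  \<open>(s i \<otimes> s j)\<^sup>k = \<one>\<close> the first assumption holds. Distinctness of the
  generators of a Coxeter group is usually read off the geometric representation; below it comes from
  the existence of a building.\<close>

locale parity_involutive_family = involutive_family +
  assumes parity_cong: "set f \<subseteq> I \<Longrightarrow> set g \<subseteq> I \<Longrightarrow> word_prod f = word_prod g \<Longrightarrow> parity f = parity g"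
    and inj_s: "inj_on s I"
begin

lemma distinct_parity: "distinct (reflections f) \<Longrightarrow> parity f t \<longleftrightarrow> t \<in> set (reflections f)"
  by (cases "t \<in> set (reflections f)") (auto simp: parity_def distinct_count_one)

text \<open>A shortest word for \<open>s i\<close> in the other letters would cross exactly the walls that
  separate \<open>\<one>\<close> from \<open>s i\<close>. There is only one, so the word would be a single letter.\<close>

lemma generator_notin_parabolic:
  assumes i: "i \<in> I" and f: "set f \<subseteq> I - {i}"
  shows "word_prod f \<noteq> s i"
proof
  assume "word_prod f = s i"
  with f obtain g where g: "set g \<subseteq> I - {i}" "word_prod g = s i" "distinct (reflections g)"
    by (metis shortest_word Diff_subset)
  have "parity g = parity [i]" using g i by (intro parity_cong) auto
  then have "set (reflections g) = {s i}"
    using distinct_parity[OF g(3)] distinct_parity[of "[i]"] by auto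
  then have "length g = 1"
    using distinct_card[OF g(3)] by simp
  then obtain j where "g = [j]" by (auto simp: length_Suc_conv)
  with g i have "j \<in> I" "j \<noteq> i" "s j = s i" by auto
  with inj_s i show False by (auto dest: inj_onD)
qed

text \<open>If \<open>w\<close> has a shortest word starting with \<open>i\<close>, then the wall \<open>s i\<close> separates
  \<open>\<one>\<close> from \<open>w\<close>. Any word for \<open>w\<close> in the other letters crosses it too, which writes
  \<open>s i\<close> itself as a product of the other letters.\<close>

theorem parabolic_intersection_trivial:
  assumes w: "w \<in> word_prod ` lists I"
    and par: "\<And>i. i \<in> I \<Longrightarrow> w \<in> word_prod ` lists (I - {i})"
  shows "w = \<one>"
proof -
  from w obtain f where f: "set f \<subseteq> I" "word_prod f = w" "distinct (reflections f)"
    using shortest_word[OF subset_refl] by (metis imageE in_listsD subsetI)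
  show ?thesis
  proof (cases f)
    case (Cons i f')
    then have i: "i \<in> I" using f by auto
    obtain g where g: "set g \<subseteq> I - {i}" "word_prod g = w" using par[OF i] by auto
    have "parity g = parity f" using f g by (intro parity_cong) auto
    moreover have "parity f (s i)" using distinct_parity[OF f(3)] Cons by simp
    ultimately have "s i \<in> set (reflections g)"
      by (metis parity_def count_notin even_zero)
    then obtain h where "set h \<subseteq> set g" "word_prod h = s i"
      using reflection_in_parabolic[of g] g by blast
    then show ?thesis using generator_notin_parabolic[OF i, of h] g by auto
  qed (use f in simp)
qed

end


section \<open>Coxeter systems\<close>

text \<open>The relator of the pair \<open>(i, i)\<close> is \<open>i i\<close>, because \<open>m i i = 1\<close>.\<close>

lemma coxeter_involutive:
  assumes "coxeter_matrix I m"
  shows "involutive_family (coxeter_group I m) (coxeter_generator I m) I"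
proof -
  let ?R = "coxeter_relators I m"
  interpret group "coxeter_group I m"
    unfolding coxeter_group_def by (rule group_presented_group)
  show ?thesis
  proof
    fix i assume i: "i \<in> I"
    then have w: "[(i, True)] \<in> words I" "[] \<in> words I" "[(i, True), (i, True)] \<in> words I"
      by (auto simp: words_def)
    then show "coxeter_generator I m i \<in> carrier (coxeter_group I m)"
      by (auto simp: coxeter_generator_def coxeter_group_def presented_group_def)
    have "m i i = 1" using assms i by (simp add: coxeter_matrix_def)
    then have "[(i, True), (i, True)] \<in> ?R"
      unfolding coxeter_relators_def using i
      by (intro CollectI exI[of _ i] conjI) (simp_all add: one_enat_def)
    then have "pres_eq I ?R [(i, True), (i, True)] []"
      using pres_eq.relator[OF w(2) w(2) _ w(3)] by simp
    then show "coxeter_generator I m i \<otimes>\<^bsub>coxeter_group I m\<^esub> coxeter_generator I m i =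
        \<one>\<^bsub>coxeter_group I m\<^esub>"
      using w(1) unfolding coxeter_generator_def coxeter_group_def
      by (subst presented_group_mult) (auto simp: presented_group_def dest: pres_class_eq)
  qed
qed

locale coxeter_system =
  fixes I :: "'i set" and m :: "'i \<Rightarrow> 'i \<Rightarrow> enat"
  assumes coxeter_matrix: "coxeter_matrix I m"
begin

sublocale involutive_family "coxeter_group I m" "coxeter_generator I m" I
  by (rule coxeter_involutive[OF coxeter_matrix])

lemma coxeter_prod_eq_word_prod: "coxeter_prod I m = word_prod"
  by (simp add: fun_eq_iff coxeter_prod_def word_prod_def)

text \<open>A formal inverse may be replaced by the letter itself. So equality in the group
  can be tested on positive words, and the inductive definition of \<open>pres_eq\<close> becomes available
  for \<open>word_prod\<close>.\<close>

lemma word_prod_eq_class: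
  assumes "u \<in> words I"
  shows "word_prod (map fst u) = pres_class I (coxeter_relators I m) u"
  using assms
proof (induction u)
  case Nil
  have "\<one>\<^bsub>coxeter_group I m\<^esub> = pres_class I (coxeter_relators I m) []"
    by (simp add: coxeter_group_def presented_group_def)
  then show ?case by simp
next
  case (Cons a u)
  let ?R = "coxeter_relators I m"
  obtain i b where a: "a = (i, b)" by (cases a)
  have i: "i \<in> I" and u: "u \<in> words I" and w: "[(i, b)] \<in> words I" "[(i, True)] \<in> words I"
    "[] \<in> words I" "[(i, False)] \<in> words I"
    using Cons.prems a by (auto simp: words_def)
  have "pres_class I ?R [(i, False)] = pres_class I ?R [(i, True)]"
  proof -
    let ?g = "\<lambda>b. pres_class I ?R [(i, b)]"
    have "pres_eq I ?R [(i, True), (i, False)] []"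
      using pres_eq.cancel[OF w(3) w(3) i, of ?R True] by simp
    then have "?g True \<otimes>\<^bsub>coxeter_group I m\<^esub> ?g False = \<one>\<^bsub>coxeter_group I m\<^esub>"
      using w unfolding coxeter_group_def
      by (subst presented_group_mult) (auto simp: presented_group_def dest: pres_class_eq)
    moreover have "?g True = coxeter_generator I m i" by (simp add: coxeter_generator_def)
    moreover have "?g False \<in> carrier (coxeter_group I m)"
      using w by (auto simp: coxeter_group_def presented_group_def)
    ultimately show ?thesis
      using s_square[OF i] s_closed[OF i] by (metis inv_equality inv_inv)
  qed
  then have "pres_class I ?R [(i, b)] = coxeter_generator I m i"
    by (cases b) (simp_all add: coxeter_generator_def)
  then have "coxeter_generator I m i \<otimes>\<^bsub>coxeter_group I m\<^esub> pres_class I ?R u = pres_class I ?R (a # u)"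
    using a presented_group_mult[OF w(1) u, of ?R] by (simp add: coxeter_group_def)
  then show ?case using Cons.IH[OF u] a by simp
qed

lemma words_map_fst: "u \<in> words I \<Longrightarrow> set (map fst u) \<subseteq> I"
  by (auto simp: words_def)

lemma relator_reflections:
  assumes "r \<in> coxeter_relators I m"
  shows "\<exists>L. reflections (map fst r) = L @ L" "set (map fst r) \<subseteq> I"
    "word_prod (map fst r) = \<one>\<^bsub>coxeter_group I m\<^esub>" "even (length r)"
proof -
  let ?W = "coxeter_group I m"
  obtain i j where ij: "i \<in> I" "j \<in> I"
    and r: "r = concat (replicate (the_enat (m i j)) [(i, True), (j, True)])"
    using assms by (auto simp: coxeter_relators_def)
  define k where "k = the_enat (m i j)"
  \<comment> \<open>the two halves of the relator cross the same walls, because \<open>x\<close> has \<open>k\<close>-th power one\<close>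
  define x where "x = coxeter_generator I m i \<otimes>\<^bsub>?W\<^esub> coxeter_generator I m j"
  have fst_r: "map fst r = concat (replicate k [i, j])"
    by (simp add: r k_def map_concat)
  show "set (map fst r) \<subseteq> I" using ij by (auto simp: fst_r)
  show "even (length r)" by (simp add: r length_concat sum_list_replicate)
  have "r \<in> words I" using ij by (auto simp: r words_def split: if_splits)
  then have "pres_eq I (coxeter_relators I m) r []"
    using pres_eq.relator[of "[]" I "[]" r] assms by (auto simp: words_def)
  then have "pres_class I (coxeter_relators I m) r = \<one>\<^bsub>?W\<^esub>"
    by (auto simp: coxeter_group_def presented_group_def dest: pres_class_eq)
  then show one: "word_prod (map fst r) = \<one>\<^bsub>?W\<^esub>"
    using \<open>r \<in> words I\<close> by (simp add: word_prod_eq_class)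
  have x: "x \<in> carrier ?W" using ij by (simp add: x_def)
  have xk: "x [^]\<^bsub>?W\<^esub> k = \<one>\<^bsub>?W\<^esub>"
    using one ij by (simp add: fst_r word_prod_alternating x_def)
  let ?h = "\<lambda>p. x [^]\<^bsub>?W\<^esub> p \<otimes>\<^bsub>?W\<^esub> coxeter_generator I m i"
  have "?h (p + k) = ?h p" for p
    using x xk by (simp flip: nat_pow_mult)
  moreover have "[0..<2 * k] = [0..<k] @ map (\<lambda>p. p + k) [0..<k]"
    by (metis add_0 map_add_upt mult_2 upt_add_eq_append zero_le)
  ultimately have "map ?h [0..<2 * k] = map ?h [0..<k] @ map ?h [0..<k]"
    by simp
  then show "\<exists>L. reflections (map fst r) = L @ L"
    unfolding fst_r reflections_alternating[OF ij] by (auto simp: x_def)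
qed

text \<open>Both invariants survive each defining step: a cancelled pair and a Coxeter
  relator have even length and cross every wall an even number of times.\<close>

lemma parity_pres_eq:
  assumes "pres_eq I (coxeter_relators I m) u v"
  shows "parity (map fst u) = parity (map fst v) \<and> (even (length u) \<longleftrightarrow> even (length v))"
  using assms
proof (induction rule: pres_eq.induct)
  case (cancel u v i b)
  have "parity (map fst u @ [i, i] @ map fst v) = parity (map fst u @ map fst v)"
    using cancel words_map_fst[of u] words_map_fst[of v]
    by (intro parity_insert[where L = "[coxeter_generator I m i]"])
      (simp_all add: inv_s s_square)
  then show ?case by simp
next
  case (relator u v r)
  obtain L where "reflections (map fst r) = L @ L" using relator_reflections(1) relator by blast
  then have "parity (map fst u @ map fst r @ map fst v) = parity (map fst u @ map fst v)"
    using relator relator_reflections words_map_fst by (intro parity_insert) blast+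
  then show ?case using relator relator_reflections(4) by simp
qed simp_all

lemma word_prod_eq_invariants:
  assumes "set f \<subseteq> I" "set g \<subseteq> I" "word_prod f = word_prod g"
  shows "parity f = parity g" "even (length f) \<longleftrightarrow> even (length g)"
proof -
  let ?p = "map (\<lambda>i. (i, True))" and ?R = "coxeter_relators I m"
  have w: "?p f \<in> words I" "?p g \<in> words I" and fst: "map fst (?p f) = f" "map fst (?p g) = g"
    using assms by (auto simp: words_def comp_def)
  then have "pres_class I ?R (?p f) = pres_class I ?R (?p g)"
    using assms(3) word_prod_eq_class by metis
  then have "pres_eq I ?R (?p f) (?p g)"
    using pres_eq.refl[OF w(2)] by (auto simp: pres_class_def)
  then show "parity f = parity g" "even (length f) \<longleftrightarrow> even (length g)"
    using parity_pres_eq fst by (metis length_map)+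
qed

lemma carrier_eq_word_prod: "carrier (coxeter_group I m) = word_prod ` lists I"
proof
  show "carrier (coxeter_group I m) \<subseteq> word_prod ` lists I"
  proof
    fix w assume "w \<in> carrier (coxeter_group I m)"
    then obtain u where "u \<in> words I" "w = pres_class I (coxeter_relators I m) u"
      by (auto simp: coxeter_group_def presented_group_def)
    then have "w = word_prod (map fst u)" "map fst u \<in> lists I"
      using word_prod_eq_class words_map_fst by (blast, blast intro: in_listsI)
    then show "w \<in> word_prod ` lists I" by blast
  qed
qed (auto simp: subset_iff intro!: word_prod_closed)

lemma coxeter_length_le: "set f \<subseteq> I \<Longrightarrow> coxeter_length I m (word_prod f) \<le> length f"
  unfolding coxeter_length_def coxeter_prod_eq_word_prod by (rule Least_le) blast

lemma reduced_iff:
  "coxeter_reduced I m f \<longleftrightarrow>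
    set f \<subseteq> I \<and> (\<forall>g. set g \<subseteq> I \<and> word_prod g = word_prod f \<longrightarrow> length f \<le> length g)"
proof
  assume "coxeter_reduced I m f"
  then show "set f \<subseteq> I \<and> (\<forall>g. set g \<subseteq> I \<and> word_prod g = word_prod f \<longrightarrow> length f \<le> length g)"
    unfolding coxeter_reduced_def coxeter_prod_eq_word_prod by (metis coxeter_length_le)
next
  assume "set f \<subseteq> I \<and> (\<forall>g. set g \<subseteq> I \<and> word_prod g = word_prod f \<longrightarrow> length f \<le> length g)"
  then show "coxeter_reduced I m f"
    unfolding coxeter_reduced_def coxeter_length_def coxeter_prod_eq_word_prod
    by (auto intro!: Least_equality)
qed

lemma reduced_word_exists:
  assumes "set f \<subseteq> I"
  obtains g where "coxeter_reduced I m g" "word_prod g = word_prod f" "length g \<le> length f"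
proof -
  let ?P = "\<lambda>g. set g \<subseteq> I \<and> word_prod g = word_prod f"
  have "?P (arg_min length ?P)" "\<And>h. ?P h \<Longrightarrow> length (arg_min length ?P) \<le> length h"
    using arg_min_nat_lemma[of ?P f length] assms by auto
  then show thesis by (intro that[of "arg_min length ?P"]) (auto simp: reduced_iff assms)
qed

end


section \<open>Galleries and residues in a building\<close>

context building
begin

sublocale coxeter_system I m
  by unfold_locales (rule coxeter)

lemma adjacent_in_C: "adjacent EC t i a b \<Longrightarrow> a \<in> C \<and> b \<in> C"
  using simplicial_graph by (auto simp: adjacent_def)

lemma adjacent_sym: "adjacent EC t i a b \<Longrightarrow> adjacent EC t i b a"
  by (simp add: adjacent_def insert_commute)

lemma gallery_Nil: "a \<in> C \<Longrightarrow> gallery_from_to C EC t [] a b \<longleftrightarrow> a = b"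
proof
  assume "gallery_from_to C EC t [] a b"
  then show "a = b" by (auto simp: gallery_from_to_def gallery_def length_Suc_conv)
next
  assume "a \<in> C" "a = b"
  then show "gallery_from_to C EC t [] a b"
    unfolding gallery_from_to_def gallery_def by (intro exI[of _ "[a]"]) simp
qed

lemma gallery_in_C:
  assumes "gallery_from_to C EC t f a b"
  shows "a \<in> C" "b \<in> C"
proof -
  obtain cs where "set cs \<subseteq> C" "length cs = Suc (length f)" "hd cs = a" "last cs = b"
    using assms by (auto simp: gallery_from_to_def gallery_def)
  moreover from this have "cs \<noteq> []" by auto
  ultimately show "a \<in> C" "b \<in> C" by auto
qed

lemma gallery_snoc:
  "gallery_from_to C EC t (f @ [i]) a b \<longleftrightarrow>
    (\<exists>d. gallery_from_to C EC t f a d \<and> adjacent EC t i d b)"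
proof
  assume "gallery_from_to C EC t (f @ [i]) a b"
  then obtain cs where cs: "set cs \<subseteq> C" "length cs = Suc (Suc (length f))" "hd cs = a" "last cs = b"
    and adj: "\<And>k. k < Suc (length f) \<Longrightarrow> adjacent EC t ((f @ [i]) ! k) (cs ! k) (cs ! Suc k)"
    by (auto simp: gallery_from_to_def gallery_def)
  obtain ds where ds: "cs = ds @ [b]" "length ds = Suc (length f)"
    using cs by (cases cs rule: rev_cases) auto
  have "gallery C EC t f ds"
    unfolding gallery_def
  proof (intro conjI allI impI)
    fix k assume "k < length f"
    then show "adjacent EC t (f ! k) (ds ! k) (ds ! Suc k)"
      using adj[of k] ds by (simp add: nth_append)
  qed (use cs ds in auto)
  moreover have "hd ds = a" using cs ds by (cases ds) auto
  moreover have "last ds = ds ! length f" using ds by (cases ds rule: rev_cases) (auto simp: nth_append)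
  then have "adjacent EC t i (last ds) b" using adj[of "length f"] ds by (simp add: nth_append)
  ultimately show "\<exists>d. gallery_from_to C EC t f a d \<and> adjacent EC t i d b"
    by (auto simp: gallery_from_to_def)
next
  assume "\<exists>d. gallery_from_to C EC t f a d \<and> adjacent EC t i d b"
  then obtain ds where ds: "gallery C EC t f ds" "hd ds = a" and b: "adjacent EC t i (last ds) b"
    by (auto simp: gallery_from_to_def)
  have len: "length ds = Suc (length f)" using ds by (simp add: gallery_def)
  then have last: "last ds = ds ! length f" by (cases ds rule: rev_cases) (auto simp: nth_append)
  have "gallery C EC t (f @ [i]) (ds @ [b])"
    unfolding gallery_def
  proof (intro conjI allI impI)
    show "set (ds @ [b]) \<subseteq> C" using ds b adjacent_in_C by (auto simp: gallery_def)
    fix k assume "k < length (f @ [i])"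
    then consider "k < length f" | "k = length f" by fastforce
    then show "adjacent EC t ((f @ [i]) ! k) ((ds @ [b]) ! k) ((ds @ [b]) ! Suc k)"
      using ds b len last by cases (auto simp: gallery_def nth_append)
  qed (use len in simp)
  moreover have "hd (ds @ [b]) = a" using ds len by (cases ds) auto
  ultimately show "gallery_from_to C EC t (f @ [i]) a b"
    by (auto simp: gallery_from_to_def intro!: exI[of _ "ds @ [b]"])
qed

lemma delta_gallery:
  "coxeter_reduced I m f \<Longrightarrow> a \<in> C \<Longrightarrow> b \<in> C \<Longrightarrow>
    \<delta> a b = word_prod f \<longleftrightarrow> gallery_from_to C EC t f a b"
  using B2 by (simp add: coxeter_prod_eq_word_prod)

lemma delta_reduced_word:
  assumes "a \<in> C" "b \<in> C"
  obtains f where "coxeter_reduced I m f" "\<delta> a b = word_prod f"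
proof -
  have "\<delta> a b \<in> word_prod ` lists I"
    using distance assms by (auto simp flip: carrier_eq_word_prod)
  then obtain f where "set f \<subseteq> I" "\<delta> a b = word_prod f" by auto
  with reduced_word_exists[of f] that show thesis by metis
qed

lemma delta_eq_one: "a \<in> C \<Longrightarrow> b \<in> C \<Longrightarrow> \<delta> a b = \<one>\<^bsub>coxeter_group I m\<^esub> \<longleftrightarrow> a = b"
  using delta_gallery[of "[]" a b] gallery_Nil by (auto simp: reduced_iff)

lemma reduced_singleton: "i \<in> I \<Longrightarrow> coxeter_reduced I m [i]"
  using word_prod_eq_invariants(2)[of "[]" "[i]"]
  by (auto simp: reduced_iff Suc_le_eq simp del: word_prod_simps)

text \<open>If two generators were equal, then, the one-letter words being reduced, two
  chambers adjacent by the one colour would be adjacent by the other; but an edge has one colour.\<close>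

lemma inj_on_generator:
  assumes "C \<noteq> {}"
  shows "inj_on (coxeter_generator I m) I"
proof (rule inj_onI)
  fix i j assume ij: "i \<in> I" "j \<in> I" "coxeter_generator I m i = coxeter_generator I m j"
  obtain a where a: "a \<in> C" using assms by blast
  then obtain b where b: "b \<in> C" "adjacent EC t i a b" using B1_ex ij by blast
  have gal: "gallery_from_to C EC t [k] a b \<longleftrightarrow> adjacent EC t k a b" for k
    using gallery_snoc[of "[]" k a b] gallery_Nil[OF a] by auto
  have "\<delta> a b = word_prod [i]" using delta_gallery reduced_singleton ij a b gal by blast
  then have "\<delta> a b = word_prod [j]" using ij by simp
  then have "adjacent EC t j a b" using delta_gallery reduced_singleton ij a b gal by blast
  with b show "i = j" by (simp add: adjacent_def)
qed

text \<open>If \<open>f\<close> is a reduced word for \<open>\<delta> a d\<close>, then by the parity of the length either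
  \<open>f i\<close> is reduced, or \<open>\<delta> a d\<close> has a reduced word \<open>h i\<close>. In the second case a gallery of that
  type ends with a chamber of the \<open>i\<close>-panel that contains \<open>d\<close> and \<open>e\<close>, and the two values
  are distinguished by whether this chamber is \<open>e\<close>.\<close>

lemma delta_step:
  assumes a: "a \<in> C" and i: "i \<in> I" and adj: "adjacent EC t i d e"
  shows "\<delta> a e \<in> {\<delta> a d, \<delta> a d \<otimes>\<^bsub>coxeter_group I m\<^esub> coxeter_generator I m i}"
proof -
  have de: "d \<in> C" "e \<in> C" using adjacent_in_C[OF adj] by auto
  obtain f where f: "coxeter_reduced I m f" "\<delta> a d = word_prod f"
    using delta_reduced_word a de by blast
  have fI: "set f \<subseteq> I" using f by (simp add: reduced_iff)
  have snoc: "word_prod (f @ [i]) = \<delta> a d \<otimes>\<^bsub>coxeter_group I m\<^esub> coxeter_generator I m i"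
    using f fI i by (simp add: word_prod_append)
  show ?thesis
  proof (cases "coxeter_reduced I m (f @ [i])")
    case True
    have "gallery_from_to C EC t (f @ [i]) a e"
      using gallery_snoc adj delta_gallery f a de by blast
    then have "\<delta> a e = word_prod (f @ [i])" using delta_gallery[OF True] a de by blast
    then show ?thesis by (simp add: snoc)
  next
    case False
    obtain h where h: "coxeter_reduced I m h" "word_prod h = word_prod (f @ [i])"
      "length h \<le> length (f @ [i])"
      using reduced_word_exists[of "f @ [i]"] fI i by auto
    have hI: "set h \<subseteq> I" using h by (simp add: reduced_iff)
    have "length h \<noteq> length (f @ [i])" using False h fI i by (auto simp: reduced_iff)
    moreover have "even (length h) \<longleftrightarrow> even (length (f @ [i]))"
      using word_prod_eq_invariants(2)[OF hI _ h(2)] fI i by simp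
    ultimately have len: "length (h @ [i]) \<le> length f"
      using h(3) by simp presburger
    have prod: "word_prod (h @ [i]) = word_prod f"
      using h hI fI i by (simp add: word_prod_append m_assoc s_square)
    have red: "coxeter_reduced I m (h @ [i])"
    proof -
      have "\<forall>g. set g \<subseteq> I \<and> word_prod g = word_prod f \<longrightarrow> length f \<le> length g"
        using f(1) unfolding reduced_iff by blast
      then show ?thesis unfolding reduced_iff prod using len hI i by (auto intro: order_trans)
    qed
    then have "gallery_from_to C EC t (h @ [i]) a d"
      using delta_gallery[OF red] f prod a de by simp
    then obtain d' where d': "gallery_from_to C EC t h a d'" "adjacent EC t i d' d"
      using gallery_snoc by blast
    show ?thesis
    proof (cases "d' = e")
      case True
      then have "\<delta> a e = word_prod h" using d' delta_gallery h a de by blast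
      then show ?thesis by (simp add: h snoc)
    next
      case False
      then have "adjacent EC t i d' e"
        using B1_trans[OF de(1) i adjacent_sym[OF d'(2)] adj] by blast
      then have "gallery_from_to C EC t (h @ [i]) a e" using d' gallery_snoc by blast
      then have "\<delta> a e = word_prod (h @ [i])" using delta_gallery[OF red] a de by blast
      then show ?thesis by (simp add: f prod)
    qed
  qed
qed

lemma gallery_delta_in_parabolic:
  assumes "J \<subseteq> I" "set f \<subseteq> J" "gallery_from_to C EC t f a b"
  shows "\<exists>g. set g \<subseteq> J \<and> \<delta> a b = word_prod g"
  using assms(2,3)
proof (induction f arbitrary: b rule: rev_induct)
  case Nil
  then have a: "a \<in> C" using gallery_in_C(1) by blast
  with Nil.prems have "a = b" using gallery_Nil by blast
  with a have "\<delta> a b = word_prod []" using delta_eq_one[of a b] by simp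
  then show ?case by (intro exI[of _ "[]"]) simp
next
  case (snoc i f)
  then obtain d where d: "gallery_from_to C EC t f a d" "adjacent EC t i d b"
    using gallery_snoc by blast
  then obtain g where g: "set g \<subseteq> J" "\<delta> a d = word_prod g"
    using snoc.IH[of d] snoc.prems by auto
  have i: "i \<in> J" "i \<in> I" using snoc.prems assms by auto
  have "word_prod (g @ [i]) = \<delta> a d \<otimes>\<^bsub>coxeter_group I m\<^esub> coxeter_generator I m i"
    using g assms(1) i by (subst word_prod_append) auto
  then consider "\<delta> a b = word_prod g" | "\<delta> a b = word_prod (g @ [i])"
    using delta_step[OF gallery_in_C(1)[OF d(1)] i(2) d(2)] g(2) by auto
  then show ?case
  proof cases
    case 1
    with g show ?thesis by blast
  next
    case 2
    with g i show ?thesis by (intro exI[of _ "g @ [i]"]) auto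
  qed
qed

text \<open>The vertex of type \<open>i\<close> of the simplex that corresponds to the chamber \<open>c\<close>.\<close>

definition corner :: "'i \<Rightarrow> 'c \<Rightarrow> 'c residue"
  where "corner i c = residue C EC t (I - {i}) c"

text \<open>The geometric core: the distance of two chambers with the same vertices lies in the
  subgroup generated by \<open>I - {i}\<close> for every \<open>i\<close>, so it is trivial.\<close>

lemma corners_determine_chamber:
  assumes "a \<in> C" "b \<in> C" "\<And>i. i \<in> I \<Longrightarrow> corner i a = corner i b"
  shows "a = b"
proof -
  have "inj_on (coxeter_generator I m) I" using inj_on_generator assms(1) by blast
  then interpret parity_involutive_family "coxeter_group I m" "coxeter_generator I m" I
    using word_prod_eq_invariants(1) by unfold_locales
  have "\<delta> a b = \<one>\<^bsub>coxeter_group I m\<^esub>"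
  proof (rule parabolic_intersection_trivial)
    show "\<delta> a b \<in> word_prod ` lists I"
      using distance assms(1,2) unfolding carrier_eq_word_prod by blast
    fix i assume i: "i \<in> I"
    have "gallery_from_to C EC t [] b b" using gallery_Nil assms by simp
    then have "b \<in> fst (corner i b)" by (auto simp: corner_def residue_def Let_def intro!: exI[of _ "[]"])
    then have "b \<in> fst (corner i a)" using assms(3)[OF i] by simp
    then obtain f where "set f \<subseteq> I - {i}" "gallery_from_to C EC t f a b"
      by (auto simp: corner_def residue_def Let_def)
    then show "\<delta> a b \<in> word_prod ` lists (I - {i})"
      using gallery_delta_in_parabolic[of "I - {i}" f a b] by auto
  qed
  then show "a = b" using delta_eq_one assms by blast
qed

end


section \<open>Topologies of pointwise convergence and discrete subsets\<close>

lemma continuous_map_pointwise_eval: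
  assumes "x \<in> topspace X"
  shows "continuous_map (pointwise_topology G act X) X (\<lambda>g. act g x)"
proof -
  have "continuous_map (pointwise_topology G act X) X
      ((\<lambda>f. f x) \<circ> (\<lambda>g. restrict (act g) (topspace X)))"
    unfolding pointwise_topology_def
    using assms by (intro continuous_map_pullback continuous_map_product_projection)
  then show ?thesis using assms by (simp add: comp_def)
qed

lemma topspace_pointwise_topology:
  assumes "\<And>g x. g \<in> G \<Longrightarrow> x \<in> topspace X \<Longrightarrow> act g x \<in> topspace X"
  shows "topspace (pointwise_topology G act X) = G"
  using assms by (auto simp: pointwise_topology_def topspace_pullback_topology)

text \<open>Together with \<open>continuous_map_pointwise_eval\<close> this is the universal property of the
  topology of pointwise convergence, by which all comparisons below are reduced to evaluations at
  single points.\<close>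

lemma continuous_map_into_pointwise:
  assumes "topspace Y \<subseteq> G" "\<And>x. x \<in> topspace X \<Longrightarrow> continuous_map Y X (\<lambda>g. act g x)"
  shows "continuous_map Y (pointwise_topology G act X) id"
  unfolding pointwise_topology_def
proof (rule continuous_map_pullback')
  show "continuous_map Y (product_topology (\<lambda>_. X) (topspace X))
      ((\<lambda>g. restrict (act g) (topspace X)) \<circ> id)"
    using assms(2) by (auto simp: continuous_map_componentwise)
qed (use assms(1) in auto)

lemma topology_eq_if_id_continuous:
  assumes "continuous_map X Y id" "continuous_map Y X id"
  shows "X = Y"
proof -
  have sub: "openin X U" if "openin Y U" "continuous_map X Y id" "continuous_map Y X id"
    for X Y :: "'a topology" and U
  proof -
    have "topspace X = topspace Y" using that by (auto simp: continuous_map_def)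
    then have "{x \<in> topspace X. id x \<in> U} = U" using openin_subset[OF that(1)] by auto
    with that show ?thesis by (metis openin_continuous_map_preimage)
  qed
  show ?thesis unfolding topology_eq using assms sub by blast
qed

text \<open>This is meant for orbit maps: an automorphism close to \<open>g\<close> often agrees with \<open>g\<close> at
  a given chamber, vertex or point, and then the topology of the target does not matter.\<close>

lemma continuous_map_locally_constant:
  assumes "\<And>g. g \<in> topspace Y \<Longrightarrow> f g \<in> topspace X"
    and "\<And>g. g \<in> topspace Y \<Longrightarrow> \<exists>N. openin Y N \<and> g \<in> N \<and> (\<forall>h\<in>N. f h = f g)"
  shows "continuous_map Y X f"
  unfolding continuous_map_def
proof (intro conjI allI impI)
  fix U
  show "openin Y {g \<in> topspace Y. f g \<in> U}"
  proof (subst openin_subopen, intro ballI)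
    fix g assume g: "g \<in> {g \<in> topspace Y. f g \<in> U}"
    then have "g \<in> topspace Y" by blast
    from assms(2)[OF this] obtain N where N: "openin Y N" "g \<in> N" "\<forall>h\<in>N. f h = f g"
      by (elim exE conjE)
    have "N \<subseteq> {g \<in> topspace Y. f g \<in> U}"
    proof
      fix h assume "h \<in> N"
      with N(3) have "f h = f g" by (rule bspec)
      then show "h \<in> {g \<in> topspace Y. f g \<in> U}"
        using g openin_subset[OF N(1)] \<open>h \<in> N\<close> by auto
    qed
    with N show "\<exists>T. openin Y T \<and> g \<in> T \<and> T \<subseteq> {g \<in> topspace Y. f g \<in> U}"
      by blast
  qed
qed (use assms(1) in auto)

lemma openin_agreement:
  assumes "\<And>g x. g \<in> G \<Longrightarrow> x \<in> D \<Longrightarrow> act g x \<in> D" "finite F" "F \<subseteq> D" "g \<in> G"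
  shows "openin (pointwise_topology G act (discrete_topology D)) {h \<in> G. \<forall>x\<in>F. act h x = act g x}"
proof -
  let ?P = "pointwise_topology G act (discrete_topology D)"
  have top: "topspace ?P = G" using assms(1) by (intro topspace_pointwise_topology) auto
  have "openin ?P {h \<in> topspace ?P. act h x \<in> {act g x}}" if "x \<in> F" for x
  proof (rule openin_continuous_map_preimage)
    show "continuous_map ?P (discrete_topology D) (\<lambda>h. act h x)"
      using that assms(3) by (intro continuous_map_pointwise_eval) auto
    show "openin (discrete_topology D) {act g x}" using that assms by auto
  qed
  then have "openin ?P ((\<Inter>x\<in>F. {h \<in> G. act h x = act g x}) \<inter> topspace ?P)"
    using assms(2) top by (intro openin_INT) auto
  moreover have "(\<Inter>x\<in>F. {h \<in> G. act h x = act g x}) \<inter> topspace ?P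
      = {h \<in> G. \<forall>x\<in>F. act h x = act g x}"
    unfolding top by blast
  ultimately show ?thesis by simp
qed

lemma discrete_subset_isolated:
  assumes "discrete_subset X S" "x \<in> S"
  shows "\<exists>U. openin X U \<and> U \<inter> S = {x}"
proof -
  have "openin (subtopology X S) {x}" using assms by (simp add: discrete_subset_def)
  then show ?thesis by (auto simp: openin_subtopology)
qed

lemma discrete_subset_if_subsets_closed:
  assumes "\<And>B. B \<subseteq> S \<Longrightarrow> closedin X B"
  shows "discrete_subset X S"
proof -
  have S: "S \<subseteq> topspace X" using assms closedin_subset by blast
  have "openin (subtopology X S) {x}" if "x \<in> S" for x
  proof -
    have "openin X (topspace X - (S - {x}))" using assms by blast
    then have "openin (subtopology X S) ((topspace X - (S - {x})) \<inter> S)"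
      by (auto simp: openin_subtopology)
    moreover have "(topspace X - (S - {x})) \<inter> S = {x}" using S that by auto
    ultimately show ?thesis by simp
  qed
  then have "discrete_topology S = subtopology X S"
    unfolding discrete_topology_unique using S by (auto simp: topspace_subtopology)
  then show ?thesis using S by (simp add: discrete_subset_def)
qed


section \<open>Simplices and the weak topology\<close>

lemma vertex_point_eq_iff [simp]: "vertex_point v = vertex_point w \<longleftrightarrow> v = w"
  by (auto simp: vertex_point_def fun_eq_iff)

lemma linear_extension_cong:
  "(\<And>v. x v \<noteq> 0 \<Longrightarrow> f v = g v) \<Longrightarrow> linear_extension f x = linear_extension g x"
  unfolding linear_extension_def by (intro ext sum.cong) auto

lemma linear_extension_vertex_point: "linear_extension f (vertex_point v) = vertex_point (f v)"
proof -
  have "{u. vertex_point v u \<noteq> 0} = {v}" by (auto simp: vertex_point_def)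
  then show ?thesis by (simp add: linear_extension_def vertex_point_def)
qed

lemma real_simplex_iff:
  assumes "finite a"
  shows "x \<in> real_simplex a \<longleftrightarrow> (\<forall>v. 0 \<le> x v) \<and> {v. x v \<noteq> 0} \<subseteq> a \<and> sum x a = 1"
proof
  have coord: "(\<Sum>v\<in>a. c v * vertex_point v u) = (if u \<in> a then c u else 0)" for c u
    using assms by (simp add: vertex_point_def sum.delta if_distrib cong: if_cong)
  show "(\<forall>v. 0 \<le> x v) \<and> {v. x v \<noteq> 0} \<subseteq> a \<and> sum x a = 1" if "x \<in> real_simplex a"
    using that by (auto simp: real_simplex_def coord split: if_splits)
  assume x: "(\<forall>v. 0 \<le> x v) \<and> {v. x v \<noteq> 0} \<subseteq> a \<and> sum x a = 1"
  then have "x = (\<lambda>u. \<Sum>v\<in>a. x v * vertex_point v u)"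
    by (auto simp: coord fun_eq_iff)
  with x show "x \<in> real_simplex a" unfolding real_simplex_def by blast
qed

lemma vertex_point_in_real_simplex: "vertex_point v \<in> real_simplex {v}"
  by (auto simp: real_simplex_iff vertex_point_def)

lemma linear_extension_real_simplex:
  assumes "finite a" "x \<in> real_simplex a"
  shows "linear_extension f x \<in> real_simplex (f ` a)"
proof -
  have x: "\<And>v. 0 \<le> x v" "{v. x v \<noteq> 0} \<subseteq> a" "sum x a = 1"
    using assms by (auto simp: real_simplex_iff)
  have ext: "linear_extension f x u = (\<Sum>v\<in>a. x v * vertex_point (f v) u)" for u
    unfolding linear_extension_def using x assms(1) by (intro sum.mono_neutral_left) auto
  have "(\<Sum>u\<in>f ` a. linear_extension f x u) = (\<Sum>v\<in>a. \<Sum>u\<in>f ` a. x v * vertex_point (f v) u)"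
    unfolding ext by (rule sum.swap)
  also have "\<dots> = (\<Sum>v\<in>a. x v)"
    using assms(1)
    by (intro sum.cong) (auto simp: vertex_point_def sum.delta if_distrib cong: if_cong)
  finally have sum: "sum (linear_extension f x) (f ` a) = 1" using x by simp
  have nonneg: "0 \<le> linear_extension f x u" for u
    unfolding ext using x by (intro sum_nonneg) (auto simp: vertex_point_def)
  have "linear_extension f x u = 0" if "u \<notin> f ` a" for u
    unfolding ext using that by (intro sum.neutral) (auto simp: vertex_point_def)
  then have "{u. linear_extension f x u \<noteq> 0} \<subseteq> f ` a" by blast
  with sum nonneg show ?thesis using assms(1) by (simp add: real_simplex_iff)
qed

lemma real_simplex_support:
  assumes "finite a" "x \<in> real_simplex a"
  shows "{v. x v \<noteq> 0} \<subseteq> a" "x \<in> real_simplex {v. x v \<noteq> 0}"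
proof -
  show sub: "{v. x v \<noteq> 0} \<subseteq> a" using assms by (simp add: real_simplex_iff)
  then have "sum x {v. x v \<noteq> 0} = sum x a"
    using assms(1) by (intro sum.mono_neutral_left) auto
  then show "x \<in> real_simplex {v. x v \<noteq> 0}"
    using assms sub by (auto simp: real_simplex_iff finite_subset)
qed

lemma closedin_weak_if_finite_on_simplices:
  assumes "A \<subseteq> realization \<Delta>" "\<And>a. a \<in> \<Delta> \<Longrightarrow> finite (A \<inter> real_simplex a)"
  shows "closedin (weak_topology \<Delta>) A"
  unfolding closedin_weak_topology
proof (intro conjI ballI)
  fix a assume "a \<in> \<Delta>"
  have "Hausdorff_space (simplex_topology a)"
    unfolding simplex_topology_def
    by (intro Hausdorff_space_subtopology) (simp add: Hausdorff_space_product_topology)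
  then show "closedin (simplex_topology a) (A \<inter> real_simplex a)"
    using assms(2)[OF \<open>a \<in> \<Delta>\<close>]
    by (intro closedin_Hausdorff_finite) (auto simp: topspace_simplex_topology)
qed (rule assms(1))

text \<open>A simplex contains only finitely many vertices, so every set of vertices is closed.\<close>

lemma vertices_discrete_in_weak_topology:
  assumes "simplicial_complex V \<Delta>"
  shows "discrete_subset (weak_topology \<Delta>) (vertex_point ` V)"
proof (rule discrete_subset_if_subsets_closed)
  fix B :: "('a \<Rightarrow> real) set" assume B: "B \<subseteq> vertex_point ` V"
  have "{v} \<in> \<Delta>" if "v \<in> V" for v
    using assms that unfolding simplicial_complex_def by (metis UnionE empty_subsetI insert_subset)
  then have sub: "B \<subseteq> realization \<Delta>"
    using B vertex_point_in_real_simplex by (fastforce simp: realization_def)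
  have "finite (B \<inter> real_simplex a)" if a: "a \<in> \<Delta>" for a
  proof -
    have fin: "finite a" using assms a by (simp add: simplicial_complex_def)
    have "B \<inter> real_simplex a \<subseteq> vertex_point ` a"
    proof
      fix x assume "x \<in> B \<inter> real_simplex a"
      then obtain v where v: "x = vertex_point v" "{u. x u \<noteq> 0} \<subseteq> a"
        using B real_simplex_support(1)[OF fin] by blast
      then have "v \<in> a" by (auto simp: vertex_point_def subset_iff)
      with v show "x \<in> vertex_point ` a" by blast
    qed
    then show ?thesis using fin by (meson finite_imageI finite_subset)
  qed
  with sub show "closedin (weak_topology \<Delta>) B" by (rule closedin_weak_if_finite_on_simplices)
qed

text \<open>Choose one point of \<open>K\<close> in each open simplex that \<open>K\<close> meets. Every set of chosen
  points meets each simplex in a finite set, hence is closed; so the chosen points form a compact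
  discrete set.\<close>

lemma compact_in_finitely_many_simplices:
  assumes "simplicial_complex V \<Delta>" "compactin (weak_topology \<Delta>) K"
  shows "\<exists>F. finite F \<and> F \<subseteq> \<Delta> \<and> K \<subseteq> realization F"
proof -
  define supp :: "('a \<Rightarrow> real) \<Rightarrow> 'a set" where "supp x = {v. x v \<noteq> 0}" for x
  have K: "K \<subseteq> realization \<Delta>"
    using compactin_subset_topspace[OF assms(2)] by (simp add: topspace_weak_topology)
  have fin: "finite a" if "a \<in> \<Delta>" for a using assms(1) that by (simp add: simplicial_complex_def)
  have supp: "supp x \<in> \<Delta>" "x \<in> real_simplex (supp x)" if x: "x \<in> K" for x
  proof -
    obtain a where a: "a \<in> \<Delta>" "x \<in> real_simplex a" using x K by (auto simp: realization_def)
    then show "x \<in> real_simplex (supp x)" "supp x \<in> \<Delta>"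
      using real_simplex_support[OF fin] assms(1) unfolding supp_def simplicial_complex_def by blast+
  qed
  \<comment> \<open>one point of \<open>K\<close> for each support that occurs in \<open>K\<close>\<close>
  obtain P where P: "P \<subseteq> K" "inj_on supp P" "supp ` P = supp ` K"
    by (metis subset_image_inj subset_refl)
  have "closedin (weak_topology \<Delta>) B" if B: "B \<subseteq> P" for B
  proof (rule closedin_weak_if_finite_on_simplices)
    fix a assume a: "a \<in> \<Delta>"
    have "supp ` (B \<inter> real_simplex a) \<subseteq> Pow a"
      using real_simplex_support(1)[OF fin[OF a]] by (auto simp: supp_def)
    then have "finite (supp ` (B \<inter> real_simplex a))"
      using fin[OF a] by (meson finite_Pow_iff finite_subset)
    then show "finite (B \<inter> real_simplex a)"
      by (rule finite_imageD) (use P B in \<open>auto intro: inj_on_subset\<close>)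
  qed (use P B K in auto)
  moreover from this have "discrete_subset (weak_topology \<Delta>) P"
    by (rule discrete_subset_if_subsets_closed)
  ultimately have "compactin (weak_topology \<Delta>) P" "subtopology (weak_topology \<Delta>) P = discrete_topology P"
    using closed_compactin[OF assms(2) P(1)] by (auto simp: discrete_subset_def)
  then have "finite P" by (metis compact_space_discrete_topology compactin_subspace)
  then have "finite (supp ` K)" using P(3) by (metis finite_imageI)
  moreover have "K \<subseteq> realization (supp ` K)" using supp(2) by (auto simp: realization_def)
  ultimately show ?thesis using supp(1) by blast
qed


section \<open>Automorphisms acting on the Tits complex\<close>

context building
begin

abbreviation auts :: "('c \<Rightarrow> 'c) set"
  where "auts \<equiv> carrier (building_Aut C EC t)"

abbreviation vertices :: "'c residue set"
  where "vertices \<equiv> tits_vertices I C EC t"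

abbreviation tits :: "'c residue set set"
  where "tits \<equiv> tits_complex I C EC t"

abbreviation chamber_topology :: "('c \<Rightarrow> 'c) topology"
  where "chamber_topology \<equiv> pointwise_topology auts (\<lambda>g. g) (discrete_topology C)"

lemma aut_iff:
  "g \<in> auts \<longleftrightarrow> g \<in> Bij C \<and> (\<forall>a\<in>C. \<forall>b\<in>C. {g a, g b} \<in> EC \<longleftrightarrow> {a, b} \<in> EC) \<and>
    (\<forall>e\<in>EC. t (g ` e) = t e)"
  by (simp add: building_Aut_def)

lemma aut_image: "g \<in> auts \<Longrightarrow> g ` C = C"
  by (auto simp: aut_iff Bij_def bij_betw_def)

lemma aut_in_C: "g \<in> auts \<Longrightarrow> a \<in> C \<Longrightarrow> g a \<in> C"
  using aut_image by blast

lemma aut_edge: "g \<in> auts \<Longrightarrow> a \<in> C \<Longrightarrow> b \<in> C \<Longrightarrow> {g a, g b} \<in> EC \<longleftrightarrow> {a, b} \<in> EC"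
  by (simp add: aut_iff)

lemma aut_adjacent:
  assumes "g \<in> auts" "a \<in> C" "b \<in> C"
  shows "adjacent EC t i (g a) (g b) \<longleftrightarrow> adjacent EC t i a b"
proof -
  have "t {g a, g b} = t {a, b}" if e: "{a, b} \<in> EC"
  proof -
    have "\<forall>e\<in>EC. t (g ` e) = t e" using assms(1) unfolding aut_iff by blast
    then have "t (g ` {a, b}) = t {a, b}" using e by (rule bspec)
    then show ?thesis by simp
  qed
  then show ?thesis unfolding adjacent_def using aut_edge[OF assms] by metis
qed

text \<open>Automorphisms are onto and reflect adjacency, so that galleries can be moved in both
  directions.\<close>

lemma aut_gallery:
  assumes g: "g \<in> auts" and c: "c \<in> C"
  shows "gallery_from_to C EC t f (g c) d' \<longleftrightarrow> (\<exists>d. gallery_from_to C EC t f c d \<and> d' = g d)"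
proof (induction f arbitrary: d' rule: rev_induct)
  case Nil
  show ?case using gallery_Nil[OF c] gallery_Nil[OF aut_in_C[OF g c]] by auto
next
  case (snoc i f)
  have "(\<exists>e. gallery_from_to C EC t f c e \<and> adjacent EC t i (g e) d') \<longleftrightarrow>
      (\<exists>d e. gallery_from_to C EC t f c e \<and> adjacent EC t i e d \<and> d' = g d)"
  proof
    assume "\<exists>e. gallery_from_to C EC t f c e \<and> adjacent EC t i (g e) d'"
    then obtain e where e: "gallery_from_to C EC t f c e" "adjacent EC t i (g e) d'" by blast
    then have "d' \<in> g ` C" using adjacent_in_C aut_image[OF g] by blast
    then obtain d where "d \<in> C" "d' = g d" by blast
    then show "\<exists>d e. gallery_from_to C EC t f c e \<and> adjacent EC t i e d \<and> d' = g d"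
      using e gallery_in_C(2)[OF e(1)] aut_adjacent[OF g] by blast
  next
    assume "\<exists>d e. gallery_from_to C EC t f c e \<and> adjacent EC t i e d \<and> d' = g d"
    then show "\<exists>e. gallery_from_to C EC t f c e \<and> adjacent EC t i (g e) d'"
      using aut_adjacent[OF g] adjacent_in_C by blast
  qed
  then show ?case unfolding gallery_snoc snoc.IH by blast
qed

lemma residue_act_residue:
  assumes g: "g \<in> auts" and c: "c \<in> C"
  shows "residue_act g (residue C EC t J c) = residue C EC t J (g c)"
proof -
  define R where "R c = {d. \<exists>f. set f \<subseteq> J \<and> gallery_from_to C EC t f c d}" for c
  have res: "residue C EC t J c = (R c, {e \<in> EC. e \<subseteq> R c})" for c
    by (simp add: residue_def R_def Let_def)
  have R: "g ` R c = R (g c)"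
  proof (intro equalityI subsetI)
    fix d' assume "d' \<in> g ` R c"
    then show "d' \<in> R (g c)" unfolding R_def using aut_gallery[OF g c] by blast
  next
    fix d' assume "d' \<in> R (g c)"
    then show "d' \<in> g ` R c" unfolding R_def using aut_gallery[OF g c] by blast
  qed
  have RC: "R c \<subseteq> C" unfolding R_def using gallery_in_C(2) by blast
  have edge: "g ` e \<in> EC \<longleftrightarrow> e \<in> EC" if e: "e \<subseteq> R c" "card e = 2" for e
  proof -
    obtain a b where "e = {a, b}" using e(2) by (auto simp: card_2_iff)
    moreover from this have "a \<in> C" "b \<in> C" using e(1) RC by auto
    ultimately show ?thesis using aut_edge[OF g, of a b] by simp
  qed
  have inj: "inj_on g C" using g unfolding aut_iff Bij_def bij_betw_def by blast
  have "(`) g ` {e \<in> EC. e \<subseteq> R c} = {e \<in> EC. e \<subseteq> R (g c)}"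
  proof (intro equalityI subsetI)
    fix e' assume "e' \<in> (`) g ` {e \<in> EC. e \<subseteq> R c}"
    then obtain e where "e' = g ` e" "e \<in> EC" "e \<subseteq> R c" by blast
    moreover from this have "g ` e \<in> EC" using edge[of e] simplicial_graph by blast
    ultimately show "e' \<in> {e \<in> EC. e \<subseteq> R (g c)}" unfolding R[symmetric] by blast
  next
    fix e' assume e': "e' \<in> {e \<in> EC. e \<subseteq> R (g c)}"
    then have "e' \<subseteq> g ` R c" unfolding R by blast
    then obtain e where e: "e \<subseteq> R c" "e' = g ` e" by (rule subset_imageE)
    have "card e' = card e"
      unfolding e(2) by (intro card_image inj_on_subset[OF inj] subset_trans[OF e(1) RC])
    then have "card e = 2" using e' simplicial_graph by simp
    then have "e \<in> EC" using edge[OF e(1)] e(2) e' by simp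
    then show "e' \<in> (`) g ` {e \<in> EC. e \<subseteq> R c}" using e by blast
  qed
  then show ?thesis by (simp add: res residue_act_def R)
qed

lemma residue_act_corner: "g \<in> auts \<Longrightarrow> c \<in> C \<Longrightarrow> residue_act g (corner i c) = corner i (g c)"
  by (simp add: corner_def residue_act_residue)

lemma vertices_eq: "vertices = {corner i c | i c. i \<in> I \<and> c \<in> C}"
  by (auto simp: tits_vertices_def corner_def)

lemma complex_eq: "tits = {(\<lambda>i. corner i c) ` K | c K. c \<in> C \<and> K \<subseteq> I}"
  by (simp add: tits_complex_def corner_def)

lemma residue_act_vertices: "g \<in> auts \<Longrightarrow> v \<in> vertices \<Longrightarrow> residue_act g v \<in> vertices"
  using residue_act_corner aut_in_C unfolding vertices_eq by fastforce

lemma simplicial_complex_tits: "simplicial_complex vertices tits"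
  using coxeter by (intro simplicial_complex_tits_complex) (simp add: coxeter_matrix_def)

lemma finite_simplex: "a \<in> tits \<Longrightarrow> finite a"
  using simplicial_complex_tits by (simp add: simplicial_complex_def)

lemma tits_act_realization:
  assumes g: "g \<in> auts" and x: "x \<in> realization tits"
  shows "tits_act g x \<in> realization tits"
proof -
  obtain a where a: "a \<in> tits" "x \<in> real_simplex a" using x by (auto simp: realization_def)
  then obtain c K where c: "c \<in> C" "K \<subseteq> I" and a_eq: "a = (\<lambda>i. corner i c) ` K"
    unfolding complex_eq by blast
  have "residue_act g ` a = (\<lambda>i. corner i (g c)) ` K"
    unfolding a_eq image_image using residue_act_corner[OF g c(1)] by simp
  then have "residue_act g ` a \<in> tits"
    unfolding complex_eq using c aut_in_C[OF g] by blast
  moreover have "tits_act g x \<in> real_simplex (residue_act g ` a)"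
    unfolding tits_act_def using linear_extension_real_simplex finite_simplex a by blast
  ultimately show ?thesis by (auto simp: realization_def)
qed


section \<open>Comparison of the topologies on the automorphism group\<close>

lemma topspace_chamber_topology: "topspace chamber_topology = auts"
  using aut_in_C by (intro topspace_pointwise_topology) auto

lemma openin_chamber_agreement:
  assumes "finite F" "F \<subseteq> C" "g \<in> auts"
  shows "openin chamber_topology {h \<in> auts. \<forall>c\<in>F. h c = g c}"
  using assms aut_in_C by (intro openin_agreement) auto

text \<open>The action on a simplex is determined by the image of any chamber that contains it, so
  it suffices to prescribe the images of finitely many chambers.\<close>

lemma agreement_on_finite_subcomplex:
  assumes F: "finite F" "F \<subseteq> tits" and g: "g \<in> auts"
  shows "\<exists>N. openin chamber_topology N \<and> g \<in> N \<and> N \<subseteq> auts \<and>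
    (\<forall>h\<in>N. \<forall>x\<in>realization F. tits_act h x = tits_act g x)"
proof -
  have "\<forall>a\<in>F. \<exists>c\<in>C. a \<subseteq> (\<lambda>i. corner i c) ` I"
    using F(2) unfolding complex_eq by blast
  \<comment> \<open>every simplex is a face of the simplex of some chamber\<close>
  then obtain ch where ch: "\<And>a. a \<in> F \<Longrightarrow> ch a \<in> C \<and> a \<subseteq> (\<lambda>i. corner i (ch a)) ` I"
    by metis
  let ?N = "{h \<in> auts. \<forall>c\<in>ch ` F. h c = g c}"
  have "tits_act h x = tits_act g x" if h: "h \<in> ?N" and x: "x \<in> realization F" for h x
  proof -
    obtain a where a: "a \<in> F" "x \<in> real_simplex a" using x by (auto simp: realization_def)
    have "h \<in> auts" "h (ch a) = g (ch a)" using h a(1) by blast+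
    have "residue_act h v = residue_act g v" if "x v \<noteq> 0" for v
    proof -
      have "v \<in> a" using real_simplex_support(1) finite_simplex a F(2) that by blast
      then obtain i where "v = corner i (ch a)" using ch a by blast
      then show ?thesis
        using residue_act_corner ch[OF a(1)] g \<open>h \<in> auts\<close> \<open>h (ch a) = g (ch a)\<close> by simp
    qed
    then show ?thesis unfolding tits_act_def by (rule linear_extension_cong)
  qed
  moreover have "openin chamber_topology ?N"
    using F(1) ch g by (intro openin_chamber_agreement) auto
  moreover have "g \<in> ?N" "?N \<subseteq> auts" using g by auto
  ultimately show ?thesis by blast
qed

lemma agreement_at_point:
  assumes "x \<in> realization tits" "g \<in> auts"
  shows "\<exists>N. openin chamber_topology N \<and> g \<in> N \<and> N \<subseteq> auts \<and> (\<forall>h\<in>N. tits_act h x = tits_act g x)"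
proof -
  obtain a where "a \<in> tits" "x \<in> real_simplex a" using assms by (auto simp: realization_def)
  then have "{a} \<subseteq> tits" "x \<in> realization {a}" by (auto simp: realization_def)
  then show ?thesis
    using agreement_on_finite_subcomplex[of "{a}" g] assms(2) by (meson finite.intros)
qed

text \<open>The image of a vertex is determined by the image of a chamber that contains it, and the
  image of a chamber by the images of its finitely many vertices.\<close>

lemma pointwise_on_vertices_eq:
  "pointwise_topology auts residue_act (discrete_topology vertices) = chamber_topology"
    (is "?P = _")
proof (rule topology_eq_if_id_continuous)
  have top: "topspace ?P = auts"
    using residue_act_vertices by (intro topspace_pointwise_topology) auto
  show "continuous_map ?P chamber_topology id"
  proof (intro continuous_map_into_pointwise continuous_map_locally_constant)
    fix c g assume c: "c \<in> topspace (discrete_topology C)" and g: "g \<in> topspace ?P"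
    then show "g c \<in> topspace (discrete_topology C)" using top aut_in_C by auto
    have "finite I" using coxeter by (simp add: coxeter_matrix_def)
    then have "openin ?P {h \<in> auts. \<forall>v\<in>(\<lambda>i. corner i c) ` I. residue_act h v = residue_act g v}"
      using c g top residue_act_vertices
      by (intro openin_agreement) (auto simp: vertices_eq)
    moreover have "h c = g c"
      if h: "h \<in> auts" "\<forall>v\<in>(\<lambda>i. corner i c) ` I. residue_act h v = residue_act g v" for h
    proof (rule corners_determine_chamber)
      show "h c \<in> C" "g c \<in> C" using h(1) c g top aut_in_C by auto
      fix i assume "i \<in> I"
      then have "residue_act h (corner i c) = residue_act g (corner i c)" using h(2) by blast
      then show "corner i (h c) = corner i (g c)" using h(1) c g top residue_act_corner by simp
    qed
    ultimately show "\<exists>N. openin ?P N \<and> g \<in> N \<and> (\<forall>h\<in>N. h c = g c)"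
      using g top by blast
  qed (use top in auto)
  show "continuous_map chamber_topology ?P id"
  proof (intro continuous_map_into_pointwise continuous_map_locally_constant)
    fix v g assume v: "v \<in> topspace (discrete_topology vertices)" and g: "g \<in> topspace chamber_topology"
    then show "residue_act g v \<in> topspace (discrete_topology vertices)"
      using residue_act_vertices topspace_chamber_topology by auto
    obtain i c where c: "c \<in> C" "v = corner i c" using v by (auto simp: vertices_eq)
    have "openin chamber_topology {h \<in> auts. \<forall>c\<in>{c}. h c = g c}"
      using c g topspace_chamber_topology by (intro openin_chamber_agreement) auto
    moreover have "residue_act h v = residue_act g v" if "h \<in> auts" "h c = g c" for h
      using that c g topspace_chamber_topology residue_act_corner by simp
    ultimately show "\<exists>N. openin chamber_topology N \<and> g \<in> N \<and> (\<forall>h\<in>N. residue_act h v = residue_act g v)"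
      using g topspace_chamber_topology by blast
  qed (use topspace_chamber_topology in auto)
qed

text \<open>A neighbourhood of a vertex that contains no other vertex shows that this topology
  is at least as fine as the one on vertices; conversely the orbit maps are locally constant for the
  chamber topology.\<close>

lemma pointwise_on_realization_eq:
  assumes X: "topspace X = realization tits" and disc: "discrete_subset X (vertex_point ` vertices)"
  shows "pointwise_topology auts tits_act X = chamber_topology" (is "?P = _")
proof (rule topology_eq_if_id_continuous)
  have top: "topspace ?P = auts"
    using tits_act_realization X by (intro topspace_pointwise_topology) auto
  have "continuous_map ?P (pointwise_topology auts residue_act (discrete_topology vertices)) id"
  proof (intro continuous_map_into_pointwise continuous_map_locally_constant)
    fix v g assume v: "v \<in> topspace (discrete_topology vertices)" and g: "g \<in> topspace ?P"
    show gv: "residue_act g v \<in> topspace (discrete_topology vertices)"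
      using v g top residue_act_vertices by auto
    have act: "tits_act h (vertex_point v) = vertex_point (residue_act h v)" for h
      by (simp add: tits_act_def linear_extension_vertex_point)
    obtain U where U: "openin X U" "U \<inter> vertex_point ` vertices = {vertex_point (residue_act g v)}"
      using discrete_subset_isolated[OF disc] gv by auto
    have "vertex_point v \<in> topspace X" using disc v by (auto simp: discrete_subset_def)
    then have "openin ?P {h \<in> topspace ?P. tits_act h (vertex_point v) \<in> U}"
      using U(1) by (intro openin_continuous_map_preimage[OF continuous_map_pointwise_eval])
    moreover have "residue_act h v = residue_act g v"
      if "h \<in> topspace ?P" "tits_act h (vertex_point v) \<in> U" for h
    proof -
      have "vertex_point (residue_act h v) \<in> U \<inter> vertex_point ` vertices"
        using that v top residue_act_vertices act by auto
      then show ?thesis using U(2) by simp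
    qed
    moreover have "tits_act g (vertex_point v) \<in> U" using U(2) act by auto
    ultimately show "\<exists>N. openin ?P N \<and> g \<in> N \<and> (\<forall>h\<in>N. residue_act h v = residue_act g v)"
      using g by blast
  qed (use top in auto)
  then show "continuous_map ?P chamber_topology id" by (simp add: pointwise_on_vertices_eq)
  show "continuous_map chamber_topology ?P id"
  proof (intro continuous_map_into_pointwise continuous_map_locally_constant)
    fix x g assume "x \<in> topspace X" "g \<in> topspace chamber_topology"
    then have xg: "x \<in> realization tits" "g \<in> auts" using X topspace_chamber_topology by auto
    show "tits_act g x \<in> topspace X" using tits_act_realization[OF xg(2,1)] X by simp
    show "\<exists>N. openin chamber_topology N \<and> g \<in> N \<and> (\<forall>h\<in>N. tits_act h x = tits_act g x)"
      using agreement_at_point[OF xg] by blast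
  qed (use topspace_chamber_topology in auto)
qed

text \<open>A point is compact, so the compact-open topology is at least as fine as the pointwise
  one, which is covered by the previous lemma. Conversely a compact set meets only finitely many
  open simplices, so automorphisms near \<open>g\<close> agree with \<open>g\<close> on all of it.\<close>

lemma compact_open_eq:
  "compact_open_topology auts tits_act (weak_topology tits) = chamber_topology"
    (is "?CO = _")
proof (rule topology_eq_if_id_continuous)
  let ?W = "weak_topology tits"
  let ?sub = "\<lambda>K U. {g \<in> auts. tits_act g ` K \<subseteq> U}"
  have top: "topspace ?CO = auts"
  proof -
    have "?sub {} {} \<in> {?sub K U | K U. compactin ?W K \<and> openin ?W U}"
      by (intro CollectI exI[of _ "{}"]) simp
    then have "auts \<in> {?sub K U | K U. compactin ?W K \<and> openin ?W U}" by simp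
    then have "\<Union>{?sub K U | K U. compactin ?W K \<and> openin ?W U} = auts" by blast
    then show ?thesis by (simp add: compact_open_topology_def)
  qed
  have open_sub: "openin ?CO (?sub K U)" if "compactin ?W K" "openin ?W U" for K U
    unfolding compact_open_topology_def using that by (intro topology_generated_by_Basis) blast
  have "continuous_map ?CO (pointwise_topology auts tits_act ?W) id"
  proof (rule continuous_map_into_pointwise)
    fix x assume x: "x \<in> topspace ?W"
    show "continuous_map ?CO ?W (\<lambda>g. tits_act g x)"
      unfolding continuous_map_def
    proof (intro conjI allI impI)
      show "(\<lambda>g. tits_act g x) \<in> topspace ?CO \<rightarrow> topspace ?W"
        using x top tits_act_realization by (auto simp: topspace_weak_topology)
      fix U assume "openin ?W U"
      then show "openin ?CO {g \<in> topspace ?CO. tits_act g x \<in> U}"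
        using open_sub[of "{x}" U] x top by simp
    qed
  qed (simp add: top)
  then show "continuous_map ?CO chamber_topology id"
    using vertices_discrete_in_weak_topology[OF simplicial_complex_tits]
    by (simp add: pointwise_on_realization_eq topspace_weak_topology)
  show "continuous_map chamber_topology ?CO id"
    unfolding compact_open_topology_def
  proof (rule continuous_on_generated_topo)
    fix S assume "S \<in> {?sub K U | K U. compactin ?W K \<and> openin ?W U}"
    then obtain K U where S: "S = ?sub K U" and K: "compactin ?W K" by blast
    obtain F where F: "finite F" "F \<subseteq> tits" "K \<subseteq> realization F"
      using compact_in_finitely_many_simplices[OF simplicial_complex_tits K] by blast
    have "openin chamber_topology S"
    proof (subst openin_subopen, intro ballI)
      fix g assume g: "g \<in> S"
      then have gK: "g \<in> auts" "tits_act g ` K \<subseteq> U" unfolding S by blast+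
      from agreement_on_finite_subcomplex[OF F(1,2) gK(1)]
      obtain N where N: "openin chamber_topology N" "g \<in> N" "N \<subseteq> auts"
        "\<forall>h\<in>N. \<forall>x\<in>realization F. tits_act h x = tits_act g x"
        by (elim exE conjE)
      have "N \<subseteq> S"
      proof
        fix h assume h: "h \<in> N"
        have "tits_act h x = tits_act g x" if "x \<in> K" for x
          by (rule bspec[OF bspec[OF N(4) h] subsetD[OF F(3) that]])
        then have "tits_act h ` K = tits_act g ` K" by (rule image_cong[OF HOL.refl])
        then show "h \<in> S" unfolding S using gK(2) h N(3) by auto
      qed
      with N(1,2) show "\<exists>T. openin chamber_topology T \<and> g \<in> T \<and> T \<subseteq> S" by blast
    qed
    moreover have "S \<subseteq> auts" using S by blast
    ultimately show "openin chamber_topology (id -` S \<inter> topspace chamber_topology)"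
      by (simp add: topspace_chamber_topology Int_absorb2)
  next
    show "id ` topspace chamber_topology \<subseteq> \<Union>{?sub K U | K U. compactin ?W K \<and> openin ?W U}"
      using top by (simp add: topspace_chamber_topology compact_open_topology_def)
  qed
qed


section \<open>Continuity of the evaluation map\<close>

lemma continuous_evaluationI:
  assumes X: "topspace X = realization tits"
    and nbhd: "\<And>g x U. g \<in> auts \<Longrightarrow> x \<in> realization tits \<Longrightarrow> openin X U \<Longrightarrow> tits_act g x \<in> U \<Longrightarrow>
      \<exists>N M. openin chamber_topology N \<and> g \<in> N \<and> openin X M \<and> x \<in> M \<and>
        (\<forall>h\<in>N. \<forall>y\<in>M. tits_act h y \<in> U)"
  shows "continuous_map (prod_topology chamber_topology X) X (\<lambda>(g, x). tits_act g x)"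
  unfolding continuous_map_def
proof (intro conjI allI impI)
  show "(\<lambda>(g, x). tits_act g x) \<in> topspace (prod_topology chamber_topology X) \<rightarrow> topspace X"
    using tits_act_realization by (auto simp: X topspace_chamber_topology)
  fix U assume U: "openin X U"
  let ?E = "{p \<in> topspace (prod_topology chamber_topology X). (case p of (g, x) \<Rightarrow> tits_act g x) \<in> U}"
  show "openin (prod_topology chamber_topology X) ?E"
    unfolding openin_prod_topology_alt
  proof (intro allI impI)
    fix g x assume "(g, x) \<in> ?E"
    then have "g \<in> auts" "x \<in> realization tits" "tits_act g x \<in> U"
      by (auto simp: X topspace_chamber_topology)
    then obtain N M where NM: "openin chamber_topology N" "g \<in> N" "openin X M" "x \<in> M"
      "\<forall>h\<in>N. \<forall>y\<in>M. tits_act h y \<in> U" using nbhd U by metis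
    then have "N \<times> M \<subseteq> ?E" using openin_subset[OF NM(1)] openin_subset[OF NM(3)] by auto
    with NM show "\<exists>N M. openin chamber_topology N \<and> openin X M \<and> g \<in> N \<and> x \<in> M \<and> N \<times> M \<subseteq> ?E"
      by blast
  qed
qed

text \<open>Near \<open>x\<close> only a finite subcomplex matters, on which automorphisms near \<open>g\<close>
  coincide with the continuous map given by \<open>g\<close>.\<close>

lemma evaluation_continuous_locally_finite:
  assumes X: "topspace X = realization tits"
    and inv: "invariant_topology auts tits_act X" and lf: "locally_finite_topology tits X"
  shows "continuous_map (prod_topology chamber_topology X) X (\<lambda>(g, x). tits_act g x)"
proof (rule continuous_evaluationI[OF X])
  fix g x U assume gx: "g \<in> auts" "x \<in> realization tits" and U: "openin X U" "tits_act g x \<in> U"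
  obtain M F where M: "openin X M" "x \<in> M" and F: "finite F" "subcomplex F tits" "M \<subseteq> realization F"
    using lf gx X unfolding locally_finite_topology_def by metis
  have "F \<subseteq> tits" using F(2) by (simp add: subcomplex_def)
  from agreement_on_finite_subcomplex[OF F(1) this gx(1)]
  obtain N where N: "openin chamber_topology N" "g \<in> N"
    "\<forall>h\<in>N. \<forall>y\<in>realization F. tits_act h y = tits_act g y"
    by (elim exE conjE)
  have "continuous_map X X (tits_act g)"
    using inv gx by (auto simp: invariant_topology_def homeomorphic_imp_continuous_map)
  then have "openin X {y \<in> topspace X. tits_act g y \<in> U}"
    using U(1) by (rule openin_continuous_map_preimage)
  then have "openin X (M \<inter> {y \<in> topspace X. tits_act g y \<in> U})" using M(1) by blast
  moreover have "x \<in> M \<inter> {y \<in> topspace X. tits_act g y \<in> U}" using M(2) U(2) gx X by simp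
  moreover have "tits_act h y \<in> U"
    if "h \<in> N" "y \<in> M \<inter> {y \<in> topspace X. tits_act g y \<in> U}" for h y
  proof -
    have "y \<in> realization F" using F(3) that(2) by blast
    then have "tits_act h y = tits_act g y" by (rule bspec[OF bspec[OF N(3) that(1)]])
    with that show ?thesis by simp
  qed
  ultimately show "\<exists>N M. openin chamber_topology N \<and> g \<in> N \<and> openin X M \<and> x \<in> M \<and>
      (\<forall>h\<in>N. \<forall>y\<in>M. tits_act h y \<in> U)"
    using N(1,2) by blast
qed

text \<open>For \<open>h\<close> near \<open>g\<close> we have \<open>h x = g x\<close>, so invariance of the metric gives
  \<open>d (h y) (g x) = d (h y) (h x) = d y x\<close>.\<close>

lemma evaluation_continuous_metric:
  assumes d: "Metric_space (realization tits) d" and inv: "invariant_metric auts tits_act (realization tits) d"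
  shows "continuous_map (prod_topology chamber_topology (Metric_space.mtopology (realization tits) d))
    (Metric_space.mtopology (realization tits) d) (\<lambda>(g, x). tits_act g x)"
proof -
  interpret Metric_space "realization tits" d by (rule d)
  show ?thesis
  proof (rule continuous_evaluationI)
    fix g x U assume gx: "g \<in> auts" "x \<in> realization tits" and U: "openin mtopology U" "tits_act g x \<in> U"
    obtain r where r: "r > 0" "mball (tits_act g x) r \<subseteq> U" using U openin_mtopology by auto
    obtain N where N: "openin chamber_topology N" "g \<in> N" "N \<subseteq> auts" "\<forall>h\<in>N. tits_act h x = tits_act g x"
      using agreement_at_point[OF gx(2,1)] by (elim exE conjE)
    have "tits_act h y \<in> U" if h: "h \<in> N" and y: "y \<in> mball x r" for h y
    proof -
      have "h \<in> auts" "y \<in> realization tits" using h y N(3) by auto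
      then have "d (tits_act h x) (tits_act h y) = d x y" "tits_act h y \<in> realization tits"
        using inv gx tits_act_realization by (auto simp: invariant_metric_def)
      moreover have "tits_act h x = tits_act g x" by (rule bspec[OF N(4) h])
      ultimately have "tits_act h y \<in> mball (tits_act g x) r"
        using y gx tits_act_realization by simp
      then show ?thesis using r by blast
    qed
    then show "\<exists>N M. openin chamber_topology N \<and> g \<in> N \<and> openin mtopology M \<and> x \<in> M \<and>
        (\<forall>h\<in>N. \<forall>y\<in>M. tits_act h y \<in> U)"
      using N(1,2) r(1) gx(2) by (metis openin_mball centre_in_mball_iff)
  qed simp
qed

end

theorem proposition5p6:
  fixes I :: "'i set" and m :: "'i \<Rightarrow> 'i \<Rightarrow> enat"
    and C :: "'c set" and EC :: "'c set set" and t :: "'c set \<Rightarrow> 'i"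
    and \<delta> :: "'c \<Rightarrow> 'c \<Rightarrow> 'i word set"
    and Aut :: "('c \<Rightarrow> 'c) set" and V :: "'c residue set" and \<Delta>T :: "'c residue set set"
    and VP :: "('c residue \<Rightarrow> real) set" and Top :: "('c \<Rightarrow> 'c) topology"
  assumes "building I m C EC t \<delta>"
  defines "Aut \<equiv> carrier (building_Aut C EC t)"
    and "V \<equiv> tits_vertices I C EC t"
    and "\<Delta>T \<equiv> tits_complex I C EC t"
    and "VP \<equiv> vertex_point ` V"
    and "Top \<equiv> pointwise_topology Aut (\<lambda>g. g) (discrete_topology C)"
  shows
    "pointwise_topology Aut residue_act (discrete_topology V) = Top \<and>
     (\<forall>X. topspace X = realization \<Delta>T \<and> Hausdorff_space X \<and> discrete_subset X VP \<longrightarrow>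
        pointwise_topology Aut tits_act X = Top) \<and>
     compact_open_topology Aut tits_act (weak_topology \<Delta>T) = Top \<and>
     (\<forall>X. topspace X = realization \<Delta>T \<and> Hausdorff_space X \<and>
        (invariant_topology Aut tits_act X \<and> locally_finite_topology \<Delta>T X \<or>
         (\<exists>d. Metric_space (realization \<Delta>T) d \<and> X = Metric_space.mtopology (realization \<Delta>T) d \<and>
            invariant_metric Aut tits_act (realization \<Delta>T) d \<and> discrete_subset X VP)) \<longrightarrow>
        continuous_map (prod_topology Top X) X (\<lambda>(g, x). tits_act g x))"
proof -
  interpret building I m C EC t \<delta> by (rule assms(1))
  show ?thesis
    unfolding Aut_def V_def \<Delta>T_def VP_def Top_def
  proof (intro conjI allI impI; (elim conjE)?)
    fix X assume "topspace X = realization tits" "discrete_subset X (vertex_point ` vertices)"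
    then show "pointwise_topology auts tits_act X = chamber_topology"
      by (rule pointwise_on_realization_eq)
  next
    fix X
    assume "topspace X = realization tits"
      and "invariant_topology auts tits_act X \<and> locally_finite_topology tits X \<or>
        (\<exists>d. Metric_space (realization tits) d \<and> X = Metric_space.mtopology (realization tits) d \<and>
          invariant_metric auts tits_act (realization tits) d \<and>
          discrete_subset X (vertex_point ` vertices))"
    then show "continuous_map (prod_topology chamber_topology X) X (\<lambda>(g, x). tits_act g x)"
      using evaluation_continuous_locally_finite evaluation_continuous_metric by blast
  qed (rule pointwise_on_vertices_eq compact_open_eq)+
qed

end
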